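(* Let $\mu,r\geq0$ and $\alpha,\beta,\gamma,\delta\in\mathbb{R}$ be such that $$0 \leq \theta:=\beta(\mu+1)-\alpha <2.$$ If $\theta=0$, assume in addition that $\gamma-\delta(\mu+1)<0$. Then, for $x\downarrow0$, $$\sum_{n=2}^\infty \frac{n^\alpha (\log n)^\gamma\sin(nx)}{\big(n^\beta (\log n)^\delta+r^2\big)^{\mu+1}} \sim \begin{cases} \dfrac{\pi}{2\Gamma(\theta)\sin( \pi \theta/2)}\, x^{\theta-1}\Big(\log \dfrac1x\Big)^{\gamma-\delta(\mu+1)} & \text{if } 0 < \theta < 2, \\[12pt] \dfrac1x \Big(\log \dfrac1x\Big)^{\gamma-\delta(\mu+1)} & \text{if } \theta =0. \end{cases}$$
   Context: Here $f(x)\sim g(x)$ as $x\downarrow 0$ means $f(x)/g(x)\to 1$, with all parameters $\mu,r,\alpha,\beta,\gamma,\delta$ fixed. The sine series is understood as the (possibly conditionally convergent) limit of its partial sums.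
   Formalization: Added assumption: r = 0, or β > 0, or β = 0 and δ > 0. Without it the claim fails, e.g. μ = 0, α = −1, β = γ = δ = 0, r = 1, where the series tends to π/4 instead of π/2. *)

theory Defs
  imports "HOL-Analysis.Analysis" "HOL-Library.Landau_Symbols"
begin

text \<open>
  The coefficient of \<open>sin (n x)\<close>. It is meant for \<open>n \<ge> 2\<close>: there \<open>ln n > 0\<close>, so every base of
  \<open>powr\<close> is positive and \<open>powr\<close> is the usual real power.
\<close>

definition mathieu_coeff ::
    "real \<Rightarrow> real \<Rightarrow> real \<Rightarrow> real \<Rightarrow> real \<Rightarrow> real \<Rightarrow> nat \<Rightarrow> real" where
  "mathieu_coeff \<mu> r \<alpha> \<beta> \<gamma> \<delta> n =
     real n powr \<alpha> * ln (real n) powr \<gamma> /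
       (real n powr \<beta> * ln (real n) powr \<delta> + r\<^sup>2) powr (\<mu> + 1)"

text \<open>The summand with index \<open>n\<close> is the one of the sine series with index \<open>n + 2\<close>.\<close>

definition mathieu_sin_term ::
    "real \<Rightarrow> real \<Rightarrow> real \<Rightarrow> real \<Rightarrow> real \<Rightarrow> real \<Rightarrow> real \<Rightarrow> nat \<Rightarrow> real" where
  "mathieu_sin_term \<mu> r \<alpha> \<beta> \<gamma> \<delta> x n =
     mathieu_coeff \<mu> r \<alpha> \<beta> \<gamma> \<delta> (n + 2) * sin (real (n + 2) * x)"

text \<open>On the reals, \<open>suminf\<close> is the limit of the partial sums, so conditional convergence is enough.\<close>

definition mathieu_sin_series ::
    "real \<Rightarrow> real \<Rightarrow> real \<Rightarrow> real \<Rightarrow> real \<Rightarrow> real \<Rightarrow> real \<Rightarrow> real" where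
  "mathieu_sin_series \<mu> r \<alpha> \<beta> \<gamma> \<delta> x = (\<Sum>n. mathieu_sin_term \<mu> r \<alpha> \<beta> \<gamma> \<delta> x n)"

text \<open>
  The asymptotic relation replaces \<open>n^\<beta> (ln n)^\<delta> + r\<^sup>2\<close> by its first summand. This is legitimate for
  arbitrary real exponents if \<open>r = 0\<close>; for \<open>r > 0\<close> it requires \<open>n^\<beta> (ln n)^\<delta> \<longlonglongrightarrow> \<infinity>\<close>, that is,
  \<open>\<beta> > 0\<close>, or \<open>\<beta> = 0\<close> and \<open>\<delta> > 0\<close>. Otherwise the relation fails: for \<open>\<beta> = \<delta> = 0\<close> the series is
  \<open>(1 + r\<^sup>2) powr - (\<mu> + 1)\<close> times the one for \<open>r = 0\<close>, while the right-hand side does not depend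
  on \<open>r\<close>. Hence the theorem carries this condition as an explicit hypothesis.
\<close>

end

theory Submission
  imports Defs "HOL-Probability.Sinc_Integral" "HOL-Real_Asymp.Real_Asymp"
begin

text \<open>
  Write \<open>X = 1 / x\<close> and let \<open>f n\<close> be the coefficients, extended to real arguments. In logarithmic
  coordinates \<open>f (exp u) = exp (\<phi> u)\<close> with \<open>\<phi>' u \<longrightarrow> -\<theta>\<close>, so the mean value theorem yields
  Potter's bounds and \<open>f (c X) / f X \<longrightarrow> c powr (-\<theta>)\<close>.

  For \<open>0 < \<theta> < 2\<close> the terms with \<open>n \<le> A X\<close> form a Riemann sum converging, after division by
  \<open>X * f X\<close>, to the integral of \<open>t powr (-\<theta>) * sin t\<close> over \<open>(0, A)\<close> (dominated convergence), while by
  Abel summation the remaining ones contribute at most \<open>4 * A powr (-\<theta>)\<close> in the limit. Then let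
  \<open>A \<longrightarrow> \<infinity>\<close>; the integral is evaluated by writing \<open>t powr (-\<theta>)\<close> as a Gamma integral and using Fubini.

  For \<open>\<theta> = 0\<close> the Abel bound does not become small as \<open>A\<close> grows. Instead one splits at \<open>\<eta> X\<close> with
  \<open>\<eta>\<close> small: the head is \<open>O(\<eta>)\<close>, and one summation by parts in the tail isolates the main term
  \<open>f (\<eta> X) * cos \<eta> / (2 * sin (x / 2))\<close> and leaves a cosine series whose coefficients
  \<open>f n - f (n + 1) = o(f n / n)\<close> are eventually decreasing because \<open>f\<close> is eventually convex.
\<close>

section \<open>The truncated sine integral\<close>

text \<open>Scaling by \<open>t\<close> in Euler's integral. Read from right to left it represents
  \<open>t powr (-\<theta>)\<close> as a mixture of exponentials; with \<open>t = A\<close> it also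
  evaluates the remainder bound in \<open>tendsto_sin_powr_integral\<close>.\<close>

lemma has_bochner_integral_Gamma:
  fixes \<theta> t :: real
  assumes "\<theta> > 0" "t > 0"
  shows "has_bochner_integral lborel (\<lambda>s. indicator {0<..} s * (s powr (\<theta> - 1) * exp (- (s * t))))
    (Gamma \<theta> * t powr (-\<theta>))"
proof -
  let ?g = "\<lambda>s::real. indicator {0<..} s * (s powr (\<theta> - 1) * exp (- s))"
  have "((\<lambda>s. s powr (\<theta> - 1) / exp s) has_integral Gamma \<theta>) {0..}"
    by (rule Gamma_integral_real[OF assms(1)])
  then have *: "((\<lambda>s. s powr (\<theta> - 1) * exp (- s)) has_integral Gamma \<theta>) {0..}"
    by (simp add: exp_minus field_simps)
  have "has_bochner_integral lborel (\<lambda>s. indicator {0..} s * (s powr (\<theta> - 1) * exp (- s))) (Gamma \<theta>)"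
  proof (rule has_bochner_integral_nn_integral)
    show "(\<integral>\<^sup>+ s. ennreal (indicator {0..} s * (s powr (\<theta> - 1) * exp (- s))) \<partial>lborel) = ennreal (Gamma \<theta>)"
      by (rule nn_integral_has_integral_lebesgue[OF _ *]) auto
  qed (use assms Gamma_real_pos in \<open>auto intro: less_imp_le\<close>)
  \<comment> \<open>Only \<open>s = 0\<close> distinguishes the two indicators, and there
    \<open>0 powr (\<theta> - 1) = 0\<close> by convention.\<close>
  moreover have "indicator {0..} s * (s powr (\<theta> - 1) * exp (- s)) = ?g s" for s :: real
    by (auto simp: indicator_def)
  ultimately have "has_bochner_integral lborel ?g (Gamma \<theta>)"
    by (simp cong: has_bochner_integral_cong)
  from lborel_has_bochner_integral_real_affine_iff[THEN iffD1, OF _ this, of t 0] assms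
  have "has_bochner_integral lborel (\<lambda>s. ?g (t * s)) (Gamma \<theta> / t)"
    by (simp add: divide_inverse mult.commute)
  from has_bochner_integral_mult_right[OF this, of "t powr (1 - \<theta>)"]
  have "has_bochner_integral lborel (\<lambda>s. t powr (1 - \<theta>) * ?g (t * s)) (t powr (1 - \<theta>) * (Gamma \<theta> / t))"
    by simp
  moreover have "t powr (1 - \<theta>) * ?g (t * s) =
      indicator {0<..} s * (s powr (\<theta> - 1) * exp (- (s * t)))" for s
  proof (cases "s > 0")
    case True
    have "t powr (1 - \<theta>) * t powr (\<theta> - 1) = 1"
      using assms by (simp add: powr_add[symmetric])
    then have "t powr (1 - \<theta>) * (t powr (\<theta> - 1) * (s powr (\<theta> - 1) * exp (- (t * s)))) =
        s powr (\<theta> - 1) * exp (- (t * s))"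
      by (metis mult.assoc mult_1)
    with True assms show ?thesis
      by (simp add: powr_mult mult_ac)
  qed (use assms in \<open>auto simp: indicator_def zero_less_mult_iff\<close>)
  moreover have "t powr (1 - \<theta>) * (Gamma \<theta> / t) = Gamma \<theta> * t powr (-\<theta>)"
    using assms by (simp add: powr_diff powr_minus field_simps)
  ultimately show ?thesis by simp
qed

text \<open>The factor \<open>1 / (1 + s\<^sup>2)\<close> is the Laplace transform of
  \<open>sin\<close>. The substitution \<open>y = s\<^sup>2 / (1 + s\<^sup>2)\<close> leads to half
  the Beta integral with parameters \<open>\<theta> / 2\<close> and \<open>1 - \<theta> / 2\<close>,
  which Euler's reflection formula evaluates.\<close>

lemma has_bochner_integral_powr_div_square_plus_1:
  fixes \<theta> :: real
  assumes "0 < \<theta>" "\<theta> < 2"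
  shows "has_bochner_integral lborel (\<lambda>s. indicator {0<..} s * (s powr (\<theta> - 1) / (1 + s\<^sup>2)))
    (pi / (2 * sin (pi * \<theta> / 2)))"
proof -
  let ?f = "\<lambda>s::real. s powr (\<theta> - 1) / (1 + s\<^sup>2)"
  let ?g = "\<lambda>y::real. sqrt (y / (1 - y))"
  let ?g' = "\<lambda>y::real. inverse (?g y) / 2 * (1 / (1 - y)\<^sup>2)"
  have eq: "?f (?g y) * ?g' y = 1 / 2 * (y powr (\<theta> / 2 - 1) * (1 - y) powr ((1 - \<theta> / 2) - 1))"
    if y: "0 < y" "y < 1" for y
  proof -
    have q: "y / (1 - y) > 0" using y by simp
    have g: "?g y = (y / (1 - y)) powr (1 / 2)" using q by (simp add: powr_half_sqrt)
    have sq: "1 + (?g y)\<^sup>2 = 1 / (1 - y)" using y by (simp add: field_simps)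
    have "?f (?g y) * ?g' y = (?g y powr (\<theta> - 1) * inverse (?g y)) * (1 - y) / (2 * (1 - y)\<^sup>2)"
      by (subst sq) (simp add: field_simps)
    also have "?g y powr (\<theta> - 1) * inverse (?g y) = (y / (1 - y)) powr (\<theta> / 2 - 1)"
    proof -
      have "(\<theta> - 1) / 2 + - (1 / 2) = \<theta> / 2 - 1" by (simp add: field_simps)
      then show ?thesis
        unfolding g by (simp add: powr_powr powr_minus[symmetric] powr_add[symmetric])
    qed
    also have "\<dots> = y powr (\<theta> / 2 - 1) / (1 - y) powr (\<theta> / 2 - 1)"
      using y by (simp add: powr_divide)
    also have "\<dots> * (1 - y) / (2 * (1 - y)\<^sup>2) = 1 / 2 * (y powr (\<theta> / 2 - 1) * (1 - y) powr (- (\<theta> / 2)))"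
    proof -
      have "Y / (Z / u) * u / (2 * u\<^sup>2) = 1 / 2 * (Y * inverse Z)" if "u > 0" "Z > 0" for Y Z u :: real
        using that by (simp add: field_simps power2_eq_square)
      from this[of "1 - y" "(1 - y) powr (\<theta> / 2)" "y powr (\<theta> / 2 - 1)"] show ?thesis
        using y by (simp add: powr_minus powr_diff)
    qed
    finally show ?thesis by simp
  qed
  have int: "set_integrable lborel {0<..<1} (\<lambda>y. ?f (?g y) * ?g' y)"
  proof -
    have "set_integrable lborel {0..1} (\<lambda>y. 1 / 2 * (y powr (\<theta> / 2 - 1) * (1 - y) powr ((1 - \<theta> / 2) - 1)))"
      using assms by (intro set_integrable_mult_right integrable_Beta) auto
    then have "set_integrable lborel {0<..<1} (\<lambda>y. 1 / 2 * (y powr (\<theta> / 2 - 1) * (1 - y) powr ((1 - \<theta> / 2) - 1)))"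
      by (rule set_integrable_subset) auto
    then show ?thesis
      by (rule set_integrable_cong[THEN iffD1, OF refl refl, rotated]) (rule eq[symmetric], auto)
  qed
  have B: "(LBINT y:{0<..<1}. ?f (?g y) * ?g' y) = 1 / 2 * Beta (\<theta> / 2) (1 - \<theta> / 2)"
  proof -
    have "((\<lambda>y. y powr (\<theta> / 2 - 1) * (1 - y) powr ((1 - \<theta> / 2) - 1)) has_integral Beta (\<theta> / 2) (1 - \<theta> / 2)) {0<..<1}"
      using has_integral_Beta_real[of "\<theta> / 2" "1 - \<theta> / 2"] assms by (simp add: has_integral_Icc_iff_Ioo)
    from has_integral_mult_right[OF this, of "1 / 2"]
    have "((\<lambda>y. ?f (?g y) * ?g' y) has_integral 1 / 2 * Beta (\<theta> / 2) (1 - \<theta> / 2)) {0<..<1}"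
      by (rule has_integral_eq[rotated]) (rule eq[symmetric], auto)
    then show ?thesis
      using set_borel_integral_eq_integral(2)[OF int] by (simp add: integral_unique)
  qed
  have einterval01: "einterval 0 1 = {0<..<1}"
    by (auto simp: einterval_def zero_ereal_def one_ereal_def)
  have einterval0i: "einterval 0 \<infinity> = {0<..}"
    by (auto simp: einterval_def zero_ereal_def)
  have lim0: "((ereal \<circ> ?g \<circ> real_of_ereal) \<longlongrightarrow> 0) (at_right 0)"
  proof -
    have "(?g \<longlongrightarrow> 0) (at_right 0)" by (auto intro!: tendsto_eq_intros)
    then show ?thesis unfolding zero_ereal_def ereal_tendsto_simps .
  qed
  have lim1: "((ereal \<circ> ?g \<circ> real_of_ereal) \<longlongrightarrow> \<infinity>) (at_left 1)"
  proof -
    have "LIM y at_left (1::real). y / (1 - y) :> at_top"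
    proof -
      have "LIM y at_left 1. inverse (1 - y :: real) :> at_top"
        by (rule filterlim_inverse_at_top)
          (auto intro!: tendsto_eq_intros simp: eventually_at_filter)
      from filterlim_tendsto_pos_mult_at_top[OF tendsto_ident_at _ this] show ?thesis
        unfolding divide_inverse by simp
    qed
    then have "filterlim ?g at_top (at_left 1)"
      by (rule filterlim_compose[OF sqrt_at_top])
    then show ?thesis unfolding one_ereal_def ereal_tendsto_simps .
  qed
  have d: "(?g has_real_derivative ?g' y) (at y)" if "0 < y" "y < 1" for y
  proof -
    have q: "y / (1 - y) > 0" using that by simp
    have 1: "((\<lambda>y. y / (1 - y)) has_real_derivative 1 / (1 - y)\<^sup>2) (at y)"
      using that by (auto intro!: derivative_eq_intros simp: power2_eq_square)
    show ?thesis
      by (rule DERIV_chain2[OF DERIV_real_sqrt[OF q] 1])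
  qed
  have nz: "1 + s\<^sup>2 \<noteq> (0::real)" for s by (smt (verit) zero_le_power2)
  have S: "set_integrable lborel (einterval 0 \<infinity>) ?f"
       "(LBINT s=0..\<infinity>. ?f s) = (LBINT y=0..1. (?f (?g y) * ?g' y))"
    by (rule interval_integral_substitution_nonneg[of 0 1 ?g ?g' ?f 0 "\<infinity>"];
        use d lim0 lim1 int einterval01 nz in
         \<open>auto simp: zero_ereal_def[symmetric] one_ereal_def[symmetric] intro!: continuous_intros\<close>)+
  have "set_integrable lborel {0<..} ?f" using S(1) einterval0i by simp
  moreover have "(LBINT s:{0<..}. ?f s) = 1 / 2 * Beta (\<theta> / 2) (1 - \<theta> / 2)"
    using S(2) B unfolding interval_lebesgue_integral_def by (simp add: einterval01 einterval0i)
  moreover have "1 / 2 * Beta (\<theta> / 2) (1 - \<theta> / 2) = pi / (2 * sin (pi * \<theta> / 2))"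
  proof -
    have "complex_of_real (Gamma (\<theta> / 2) * Gamma (1 - \<theta> / 2)) = complex_of_real (pi / sin (pi * \<theta> / 2))"
      using Gamma_reflection_complex[of "of_real (\<theta> / 2)"]
      by (simp add: Gamma_complex_of_real[symmetric] sin_of_real[symmetric])
    then have "Gamma (\<theta> / 2) * Gamma (1 - \<theta> / 2) = pi / sin (pi * \<theta> / 2)"
      unfolding of_real_eq_iff .
    then show ?thesis by (simp add: Beta_def)
  qed
  ultimately show ?thesis
    unfolding set_integrable_def set_lebesgue_integral_def has_bochner_integral_iff by simp
qed

lemma set_integrable_powr_from_0:
  fixes a c :: real
  assumes "a > -1"
  shows "set_integrable lborel {0<..<c} (\<lambda>t. t powr a)"
proof (cases "c > 0")
  case True
  have "((\<lambda>t. t powr a) has_integral c powr (a + 1) / (a + 1)) {0..c}"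
    using assms True by (intro has_integral_powr_from_0) auto
  then have *: "((\<lambda>t. t powr a) has_integral c powr (a + 1) / (a + 1)) {0<..<c}"
    by (simp add: has_integral_Icc_iff_Ioo)
  have "has_bochner_integral lborel (\<lambda>t. indicator {0<..<c} t * t powr a) (c powr (a + 1) / (a + 1))"
  proof (rule has_bochner_integral_nn_integral)
    show "(\<integral>\<^sup>+ t. ennreal (indicator {0<..<c} t * t powr a) \<partial>lborel) = ennreal (c powr (a + 1) / (a + 1))"
      by (rule nn_integral_has_integral_lebesgue[OF _ *]) auto
  qed (use assms in auto)
  then show ?thesis
    by (simp add: set_integrable_def has_bochner_integral_iff)
qed (simp add: set_integrable_def)

text \<open>For \<open>\<theta> \<le> 1\<close> the integrand is not absolutely integrable at
  infinity, so Fubini is applied on \<open>(0, A)\<close>. The inner integral of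
  \<open>exp (- (s * t)) * sin t\<close> splits into \<open>1 / (1 + s\<^sup>2)\<close>, which
  produces \<open>J\<close>, and a part with the factor \<open>exp (- (s * A))\<close>, whose
  contribution vanishes as \<open>A\<close> grows.\<close>

lemma tendsto_sin_powr_integral:
  fixes \<theta> :: real
  assumes "0 < \<theta>" "\<theta> < 2"
  shows "((\<lambda>A. LBINT t:{0<..<A}. t powr (-\<theta>) * sin t) \<longlongrightarrow>
    pi / (2 * Gamma \<theta> * sin (pi * \<theta> / 2))) at_top"
proof -
  define J where "J = pi / (2 * sin (pi * \<theta> / 2))"
  let ?I = "\<lambda>A. LBINT t:{0<..<A}. t powr (-\<theta>) * sin t"
  have G: "Gamma \<theta> > 0" using assms by (simp add: Gamma_real_pos)
  have main: "\<bar>Gamma \<theta> * ?I A - J\<bar> \<le> 2 * Gamma \<theta> * A powr (-\<theta>)" if A: "A > 0" for A :: real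
  proof -
    let ?f = "\<lambda>t s::real. indicator {0<..<A} t * (sin t * (indicator {0<..} s * (s powr (\<theta> - 1) * exp (- (s * t)))))"
    let ?R = "\<lambda>s::real. indicator {0<..} s * (s powr (\<theta> - 1) * (exp (- (s * A)) * (s * sin A + cos A) / (1 + s\<^sup>2)))"
    have hb: "has_bochner_integral lborel (?f t) (Gamma \<theta> * (indicator {0<..<A} t * (t powr (-\<theta>) * sin t)))" for t
    proof (cases "t \<in> {0<..<A}")
      case True
      have "has_bochner_integral lborel (\<lambda>s. sin t * (indicator {0<..} s * (s powr (\<theta> - 1) * exp (- (s * t)))))
          (sin t * (Gamma \<theta> * t powr (-\<theta>)))"
        using True assms by (intro has_bochner_integral_mult_right has_bochner_integral_Gamma) auto
      with True show ?thesis by (simp add: mult_ac)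
    qed (simp add: has_bochner_integral_zero)
    have hb': "has_bochner_integral lborel (\<lambda>s. norm (?f t s))
        (Gamma \<theta> * (indicator {0<..<A} t * (t powr (-\<theta>) * \<bar>sin t\<bar>)))" for t
    proof (cases "t \<in> {0<..<A}")
      case True
      have "has_bochner_integral lborel (\<lambda>s. \<bar>sin t\<bar> * (indicator {0<..} s * (s powr (\<theta> - 1) * exp (- (s * t)))))
          (\<bar>sin t\<bar> * (Gamma \<theta> * t powr (-\<theta>)))"
        using True assms by (intro has_bochner_integral_mult_right has_bochner_integral_Gamma) auto
      with True show ?thesis by (simp add: mult_ac abs_mult)
    qed (auto simp: has_bochner_integral_zero indicator_def)
    \<comment> \<open>The estimate \<open>\<bar>sin t\<bar> \<le> t\<close> improves the singularity
      at 0 to \<open>t powr (1 - \<theta>)\<close>, whose exponent exceeds -1 because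
      \<open>\<theta> < 2\<close>.\<close>
    have "integrable lborel (\<lambda>t. indicator {0<..<A} t * (t powr (-\<theta>) * \<bar>sin t\<bar>))"
    proof (rule Bochner_Integration.integrable_bound)
      show "integrable lborel (\<lambda>t. indicator {0<..<A} t *\<^sub>R (t powr (1 - \<theta>)))"
        using set_integrable_powr_from_0[of "1 - \<theta>" A] assms by (simp add: set_integrable_def)
      have "t powr (-\<theta>) * \<bar>sin t\<bar> \<le> t powr (1 - \<theta>)" if "t > 0" for t :: real
      proof -
        have "t powr (-\<theta>) * \<bar>sin t\<bar> \<le> t powr (-\<theta>) * t"
          using abs_sin_x_le_abs_x[of t] that by (intro mult_left_mono) auto
        also have "\<dots> = t powr (1 - \<theta>)"
          using that by (simp add: powr_diff powr_minus field_simps)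
        finally show ?thesis .
      qed
      then show "AE t in lborel. norm (indicator {0<..<A} t * (t powr (-\<theta>) * \<bar>sin t\<bar>))
          \<le> norm (indicator {0<..<A} t *\<^sub>R t powr (1 - \<theta>))"
        by (auto simp: indicator_def)
    qed simp
    then have int1: "integrable lborel (\<lambda>t. Gamma \<theta> * (indicator {0<..<A} t * (t powr (-\<theta>) * \<bar>sin t\<bar>)))"
      by simp
    have inner: "(LBINT t. ?f t s) = indicator {0<..} s * (s powr (\<theta> - 1) / (1 + s\<^sup>2)) - ?R s" for s
    proof (cases "s > 0")
      case True
      have "(LBINT t. ?f t s) = (LBINT t. s powr (\<theta> - 1) * (indicator {0<..<A} t *\<^sub>R (exp (- (s * t)) * sin t)))"
        using True by (intro Bochner_Integration.integral_cong) (auto simp: mult_ac)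
      also have "\<dots> = s powr (\<theta> - 1) * (LBINT t=0..A. exp (- (s * t)) * sin t)"
        using A by (simp add: interval_lebesgue_integral_le_eq set_lebesgue_integral_def zero_ereal_def)
      also have "\<dots> = s powr (\<theta> - 1) / (1 + s\<^sup>2) -
          s powr (\<theta> - 1) * (exp (- (s * A)) * (s * sin A + cos A) / (1 + s\<^sup>2))"
        by (subst LBINT_I0c_exp_mscale_sin) (simp add: algebra_simps diff_divide_distrib add_divide_distrib)
      finally show ?thesis using True by simp
    qed simp
    \<comment> \<open>By \<open>s + 1 \<le> 2 * (1 + s\<^sup>2)\<close> the remainder is dominated
      by twice the Gamma integrand at \<open>t = A\<close>; hence the error
      \<open>2 * Gamma \<theta> * A powr (-\<theta>)\<close>.\<close>
    have Rb: "norm (?R s) \<le> norm (2 * (indicator {0<..} s * (s powr (\<theta> - 1) * exp (- (s * A)))))" for s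
    proof (cases "s > 0")
      case True
      have "\<bar>s * sin A + cos A\<bar> \<le> s * 1 + 1"
        using True by (intro order_trans[OF abs_triangle_ineq] add_mono) (auto simp: abs_mult intro!: mult_left_mono)
      also have "\<dots> \<le> 2 * (1 + s\<^sup>2)"
      proof -
        have "s \<le> s\<^sup>2 + 1 / 4"
          using zero_le_power2[of "s - 1 / 2"] by (simp add: power2_diff power_divide)
        then show ?thesis using zero_le_power2[of s] by argo
      qed
      finally have "\<bar>s * sin A + cos A\<bar> / (1 + s\<^sup>2) \<le> 2"
        by (subst pos_divide_le_eq) (auto simp: add_pos_nonneg)
      then have "s powr (\<theta> - 1) * exp (- (s * A)) * (\<bar>s * sin A + cos A\<bar> / (1 + s\<^sup>2))
          \<le> s powr (\<theta> - 1) * exp (- (s * A)) * 2"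
        by (intro mult_left_mono) auto
      then show ?thesis using True by (simp add: abs_mult mult_ac)
    qed simp
    have bnd: "has_bochner_integral lborel (\<lambda>s. 2 * (indicator {0<..} s * (s powr (\<theta> - 1) * exp (- (s * A)))))
       (2 * (Gamma \<theta> * A powr (-\<theta>)))"
      using assms A by (intro has_bochner_integral_mult_right has_bochner_integral_Gamma)
    have intR: "integrable lborel ?R"
      by (rule Bochner_Integration.integrable_bound[OF integrable.intros[OF bnd] _ AE_I2[OF Rb]]) simp
    have J: "has_bochner_integral lborel (\<lambda>s. indicator {0<..} s * (s powr (\<theta> - 1) / (1 + s\<^sup>2))) J"
      unfolding J_def by (rule has_bochner_integral_powr_div_square_plus_1[OF assms])
    have "Gamma \<theta> * ?I A = (LBINT t. LBINT s. ?f t s)"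
      unfolding has_bochner_integral_integral_eq[OF hb] by (simp add: set_lebesgue_integral_def)
    also have "\<dots> = (LBINT s. LBINT t. ?f t s)"
    proof (rule lborel_pair.Fubini_integral[symmetric], rule lborel_pair.Fubini_integrable)
      show "(\<lambda>(x, y). ?f x y) \<in> borel_measurable (lborel \<Otimes>\<^sub>M lborel)"
        by measurable
      show "integrable lborel (\<lambda>x. LBINT y. norm (case (x, y) of (x, y) \<Rightarrow> ?f x y))"
        unfolding prod.case has_bochner_integral_integral_eq[OF hb'] by (rule int1)
      show "AE x in lborel. integrable lborel (\<lambda>y. case (x, y) of (x, y) \<Rightarrow> ?f x y)"
        unfolding prod.case by (intro AE_I2 integrable.intros[OF hb])
    qed
    also have "\<dots> = J - (LBINT s. ?R s)"
      unfolding inner Bochner_Integration.integral_diff[OF integrable.intros[OF J] intR]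
        has_bochner_integral_integral_eq[OF J] ..
    finally have "\<bar>Gamma \<theta> * ?I A - J\<bar> = \<bar>LBINT s. ?R s\<bar>" by simp
    also have "\<dots> \<le> (LBINT s. norm (?R s))"
      using integral_norm_bound[of lborel ?R] by simp
    also have "\<dots> \<le> (LBINT s. norm (2 * (indicator {0<..} s * (s powr (\<theta> - 1) * exp (- (s * A))))))"
      by (intro integral_mono_AE AE_I2 Rb integrable_norm intR integrable.intros[OF bnd])
    also have "\<dots> = (LBINT s. 2 * (indicator {0<..} s * (s powr (\<theta> - 1) * exp (- (s * A)))))"
      by (intro Bochner_Integration.integral_cong) auto
    also have "\<dots> = 2 * (Gamma \<theta> * A powr (-\<theta>))"
      by (rule has_bochner_integral_integral_eq[OF bnd])
    finally show ?thesis by simp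
  qed
  have "((\<lambda>A. 2 * Gamma \<theta> * A powr (-\<theta>)) \<longlongrightarrow> 2 * Gamma \<theta> * 0) at_top"
    using assms by (intro tendsto_mult tendsto_const tendsto_neg_powr filterlim_ident) auto
  then have "((\<lambda>A. Gamma \<theta> * ?I A - J) \<longlongrightarrow> 0) at_top"
    unfolding mult_zero_right
  proof (rule Lim_null_comparison[rotated])
    show "\<forall>\<^sub>F A in at_top. norm (Gamma \<theta> * ?I A - J) \<le> 2 * Gamma \<theta> * A powr (-\<theta>)"
      using eventually_gt_at_top[of "0::real"] by eventually_elim (simp only: real_norm_def main)
  qed
  from tendsto_divide[OF tendsto_add[OF this tendsto_const[of J]] tendsto_const[of "Gamma \<theta>"]] G
  have "(?I \<longlongrightarrow> J / Gamma \<theta>) at_top" by simp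
  then show ?thesis by (simp add: J_def mult_ac)
qed

section \<open>Abel summation\<close>

text \<open>Summation by parts: the weights \<open>b k - b (Suc k)\<close> and the last one,
  \<open>b n\<close>, are nonnegative and add up to \<open>b 0\<close>, and each multiplies a
  partial sum of \<open>c\<close>.\<close>

lemma abs_sum_mult_decseq_le:
  fixes b c :: "nat \<Rightarrow> real"
  assumes dec: "decseq b" and nonneg: "\<And>n. b n \<ge> 0" and K: "\<And>n. \<bar>\<Sum>k<n. c k\<bar> \<le> K"
  shows "\<bar>\<Sum>k<n. b k * c k\<bar> \<le> b 0 * K"
proof -
  have eq: "(\<Sum>k<n. b k * c k) = b n * (\<Sum>k<n. c k) + (\<Sum>k<n. (b k - b (Suc k)) * (\<Sum>j<Suc k. c j))"
    by (induction n) (auto simp: algebra_simps)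
  have "\<bar>\<Sum>k<n. b k * c k\<bar> \<le> \<bar>b n * (\<Sum>k<n. c k)\<bar> + (\<Sum>k<n. \<bar>(b k - b (Suc k)) * (\<Sum>j<Suc k. c j)\<bar>)"
    unfolding eq by (intro order_trans[OF abs_triangle_ineq] add_left_mono sum_abs)
  also have "\<dots> \<le> b n * K + (\<Sum>k<n. (b k - b (Suc k)) * K)"
    unfolding abs_mult using nonneg[of n] decseq_SucD[OF dec]
    by (intro add_mono sum_mono mult_mono K) auto
  also have "\<dots> = b 0 * K"
    by (simp only: sum_distrib_right[symmetric] sum_lessThan_telescope') (simp add: algebra_simps)
  finally show ?thesis .
qed

text \<open>Multiplication by \<open>2 * sin (x / 2)\<close> makes the sum telescope to a difference
  of two cosines. The free phase \<open>a\<close> covers shifted sums and, with an offset of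
  \<open>pi / 2\<close>, cosine sums.\<close>

lemma abs_sum_sin_le:
  fixes a x :: real
  assumes "sin (x / 2) \<noteq> 0"
  shows "\<bar>\<Sum>k<n. sin (a + real k * x)\<bar> \<le> 1 / \<bar>sin (x / 2)\<bar>"
proof -
  have "2 * sin (x / 2) * sin (a + real k * x) = cos (a + (real k - 1 / 2) * x) - cos (a + (real (Suc k) - 1 / 2) * x)" for k
    using cos_diff[of "a + real k * x" "x / 2"] cos_add[of "a + real k * x" "x / 2"]
    by (simp add: algebra_simps)
  then have "2 * sin (x / 2) * (\<Sum>k<n. sin (a + real k * x)) =
      (\<Sum>k<n. cos (a + (real k - 1 / 2) * x) - cos (a + (real (Suc k) - 1 / 2) * x))"
    by (simp only: sum_distrib_left)
  also have "\<dots> = cos (a - x / 2) - cos (a + (real n - 1 / 2) * x)"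
    by (subst sum_lessThan_telescope') simp
  also have "\<bar>\<dots>\<bar> \<le> 1 + 1"
    by (intro order_trans[OF abs_triangle_ineq4] add_mono abs_cos_le_one)
  finally have "2 * (\<bar>sin (x / 2)\<bar> * \<bar>\<Sum>k<n. sin (a + real k * x)\<bar>) \<le> 2"
    by (simp add: abs_mult mult.assoc)
  with assms show ?thesis by (simp add: field_simps)
qed

text \<open>Dirichlet's test with an explicit bound. The Abel estimate for the sequence shifted by
  \<open>m\<close> bounds every block starting at \<open>m\<close> by
  \<open>b m / \<bar>sin (x / 2)\<bar>\<close>; this tends to 0, which gives the Cauchy criterion,
  and \<open>m = 0\<close> bounds the sum.\<close>

lemma
  fixes a x :: real and b :: "nat \<Rightarrow> real"
  assumes dec: "decseq b" and lim: "b \<longlonglongrightarrow> 0" and x: "sin (x / 2) \<noteq> 0"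
  shows summable_decseq_mult_sin: "summable (\<lambda>k. b k * sin (a + real k * x))" (is "summable ?f")
    and abs_suminf_decseq_mult_sin_le: "\<bar>\<Sum>k. b k * sin (a + real k * x)\<bar> \<le> b 0 / \<bar>sin (x / 2)\<bar>"
proof -
  have nonneg: "b n \<ge> 0" for n
    using decseq_ge[OF dec lim] .
  have bound: "\<bar>\<Sum>k<n. b (k + m) * sin (a + real (k + m) * x)\<bar> \<le> b m / \<bar>sin (x / 2)\<bar>" for m n
    using abs_sum_mult_decseq_le[of "\<lambda>k. b (k + m)" "\<lambda>k. sin ((a + real m * x) + real k * x)" "1 / \<bar>sin (x / 2)\<bar>" n]
      abs_sum_sin_le[OF x, of "a + real m * x"] nonneg dec
    by (simp add: decseq_def algebra_simps)
  show sm: "summable ?f"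
  proof (rule summable_Cauchy[THEN iffD2], intro allI impI)
    fix e :: real assume e: "e > 0"
    have "(\<lambda>m. b m / \<bar>sin (x / 2)\<bar>) \<longlonglongrightarrow> 0 / \<bar>sin (x / 2)\<bar>"
      using lim x by (intro tendsto_divide tendsto_const) auto
    then have "\<forall>\<^sub>F m in sequentially. b m / \<bar>sin (x / 2)\<bar> < e"
      using e by (intro order_tendstoD(2)) auto
    then obtain M where M: "\<And>m. m \<ge> M \<Longrightarrow> b m / \<bar>sin (x / 2)\<bar> < e"
      by (auto simp: eventually_sequentially)
    have "norm (sum ?f {m..<n}) < e" if "m \<ge> M" for m n
    proof (cases "m \<le> n")
      case True
      have "sum ?f {m..<n} = (\<Sum>k<n - m. ?f (k + m))"
        using sum.shift_bounds_nat_ivl[of ?f 0 m "n - m"] True by (simp add: atLeast0LessThan)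
      then show ?thesis using bound[where m=m and n="n - m"] M[OF that] by simp
    qed (use e in auto)
    then show "\<exists>N. \<forall>m\<ge>N. \<forall>n. norm (sum ?f {m..<n}) < e" by blast
  qed
  show "\<bar>suminf ?f\<bar> \<le> b 0 / \<bar>sin (x / 2)\<bar>"
    by (rule LIMSEQ_le_const2[OF tendsto_rabs[OF summable_LIMSEQ[OF sm]]]) (use bound[of 0] in auto)
qed

text \<open>Organises the double limit: first \<open>X\<close> along \<open>F\<close> for a fixed
  cutoff \<open>A\<close>, then \<open>A\<close> along \<open>G\<close>. The error \<open>r\<close>
  need not vanish for fixed \<open>A\<close>; only its limit \<open>\<rho> A\<close> must become
  small. The cutoff tends to infinity if \<open>\<theta> > 0\<close> and to 0 from the right if
  \<open>\<theta> = 0\<close>.\<close>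

lemma tendsto_by_approximation:
  fixes D :: "'a \<Rightarrow> real" and I \<rho> :: "'b \<Rightarrow> real"
  assumes G: "G \<noteq> bot" and I: "(I \<longlongrightarrow> C) G" and \<rho>: "(\<rho> \<longlongrightarrow> 0) G"
    and approx: "\<forall>\<^sub>F A in G. \<exists>H r. (H \<longlongrightarrow> I A) F \<and> (r \<longlongrightarrow> \<rho> A) F \<and> (\<forall>\<^sub>F X in F. \<bar>D X - H X\<bar> \<le> r X)"
  shows "(D \<longlongrightarrow> C) F"
proof (rule tendstoI)
  fix e :: real assume e: "e > 0"
  \<comment> \<open>Four errors of \<open>e / 4\<close> occur: \<open>I A\<close> against
    \<open>C\<close>, \<open>\<rho> A\<close> against 0, \<open>H X\<close> against
    \<open>I A\<close>, and \<open>r X\<close> against \<open>\<rho> A\<close>.\<close>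
  have "\<forall>\<^sub>F A in G. dist (I A) C < e / 4" "\<forall>\<^sub>F A in G. dist (\<rho> A) 0 < e / 4"
    using e by (intro tendstoD[OF I] tendstoD[OF \<rho>]; simp)+
  with approx have "\<forall>\<^sub>F A in G. dist (I A) C < e / 4 \<and> dist (\<rho> A) 0 < e / 4 \<and>
      (\<exists>H r. (H \<longlongrightarrow> I A) F \<and> (r \<longlongrightarrow> \<rho> A) F \<and> (\<forall>\<^sub>F X in F. \<bar>D X - H X\<bar> \<le> r X))"
    by eventually_elim blast
  from eventually_happens'[OF G this] obtain A H r
    where A: "dist (I A) C < e / 4" "dist (\<rho> A) 0 < e / 4"
      and H: "(H \<longlongrightarrow> I A) F" and r: "(r \<longlongrightarrow> \<rho> A) F" and D: "\<forall>\<^sub>F X in F. \<bar>D X - H X\<bar> \<le> r X"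
    by blast
  have "\<forall>\<^sub>F X in F. dist (H X) (I A) < e / 4" "\<forall>\<^sub>F X in F. dist (r X) (\<rho> A) < e / 4"
    using e by (intro tendstoD[OF H] tendstoD[OF r]; simp)+
  with D show "\<forall>\<^sub>F X in F. dist (D X) C < e"
    by eventually_elim (use A in \<open>unfold dist_real_def, linarith\<close>)
qed

section \<open>Regularly varying functions\<close>

text \<open>\<open>h u\<close> is the logarithmic derivative \<open>t * f' t / f t\<close> at
  \<open>t = exp u\<close>. Its convergence to \<open>-\<theta>\<close> is von Mises' condition for
  regular variation of index \<open>-\<theta>\<close>. Nothing is assumed about \<open>f\<close>
  below \<open>exp U\<close>, so finitely many coefficients are left uncontrolled.\<close>

locale regularly_varying =
  fixes f \<phi> h :: "real \<Rightarrow> real" and \<theta> U :: real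
  assumes U_nonneg: "U \<ge> 0"
    and f_eq: "t \<ge> exp U \<Longrightarrow> f t = exp (\<phi> (ln t))"
    and deriv: "u \<ge> U \<Longrightarrow> (\<phi> has_real_derivative h u) (at u)"
    and h_lim: "(h \<longlongrightarrow> -\<theta>) at_top"
begin

section \<open>Comparing values of \<open>f\<close> at large arguments\<close>

lemma f_pos: "t \<ge> exp U \<Longrightarrow> f t > 0"
  by (simp add: f_eq)

lemma exp_U_ge_1: "exp U \<ge> 1"
  using U_nonneg by simp

lemma eventually_f_pos: "\<forall>\<^sub>F t in at_top. f t > 0"
  using eventually_ge_at_top[of "exp U"] by eventually_elim (rule f_pos)

text \<open>The function \<open>\<phi> u + \<theta> * u\<close> has derivative
  \<open>h u + \<theta>\<close>, which is at most \<epsilon> in absolute value from some point on;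
  the mean value inequality is applied between \<open>ln t\<close> and \<open>ln s\<close>.\<close>

lemma ln_ratio_bound:
  assumes "\<epsilon> > 0"
  obtains T where "T \<ge> exp U"
    "\<And>s t. s \<ge> T \<Longrightarrow> t \<ge> T \<Longrightarrow> \<bar>ln (f s / f t) + \<theta> * ln (s / t)\<bar> \<le> \<epsilon> * \<bar>ln (s / t)\<bar>"
proof -
  have "\<forall>\<^sub>F u in at_top. dist (h u) (-\<theta>) < \<epsilon>"
    using h_lim assms by (rule tendstoD)
  then obtain V0 where V0: "\<And>u. u \<ge> V0 \<Longrightarrow> \<bar>h u + \<theta>\<bar> < \<epsilon>"
    by (auto simp: eventually_at_top_linorder dist_real_def)
  define V where "V = max U V0"
  show thesis
  proof
    show "exp V \<ge> exp U" by (simp add: V_def)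
    fix s t assume st: "s \<ge> exp V" "t \<ge> exp V"
    then have pos: "s > 0" "t > 0" by (meson exp_gt_zero less_le_trans)+
    have ln: "ln s \<ge> V" "ln t \<ge> V" using st pos by (simp_all add: ln_ge_iff)
    have fst: "f s = exp (\<phi> (ln s))" "f t = exp (\<phi> (ln t))"
      using st \<open>exp V \<ge> exp U\<close> by (auto intro!: f_eq elim: order_trans[rotated])
    have "norm ((\<phi> (ln s) + \<theta> * ln s) - (\<phi> (ln t) + \<theta> * ln t)) \<le> \<epsilon> * norm (ln s - ln t)"
    proof (rule field_differentiable_bound[of "{V..}" _ "\<lambda>u. h u + \<theta>"])
      fix u assume "u \<in> {V..}"
      then have u: "u \<ge> U" "u \<ge> V0" by (auto simp: V_def)
      show "((\<lambda>u. \<phi> u + \<theta> * u) has_field_derivative h u + \<theta>) (at u within {V..})"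
        using deriv[OF u(1)] by (auto intro!: derivative_eq_intros intro: has_field_derivative_at_within)
      show "norm (h u + \<theta>) \<le> \<epsilon>" using V0[OF u(2)] by simp
    qed (use ln in auto)
    moreover have "ln (f s / f t) = \<phi> (ln s) - \<phi> (ln t)"
      by (simp add: fst exp_diff[symmetric])
    ultimately show "\<bar>ln (f s / f t) + \<theta> * ln (s / t)\<bar> \<le> \<epsilon> * \<bar>ln (s / t)\<bar>"
      using pos by (simp add: ln_div algebra_simps)
  qed
qed

text \<open>Exponentiates \<open>ln_ratio_bound\<close>. The sum of the powers with exponents
  \<epsilon> and -\<epsilon> dominates \<open>exp (\<epsilon> * \<bar>ln (s / t)\<bar>)\<close>
  whichever of \<open>s\<close> and \<open>t\<close> is larger.\<close>

lemma Potter_bound: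
  assumes "\<epsilon> > 0"
  obtains T where "T \<ge> exp U"
    "\<And>s t. s \<ge> T \<Longrightarrow> t \<ge> T \<Longrightarrow>
      f s / f t \<le> (s / t) powr (-\<theta>) * ((s / t) powr \<epsilon> + (s / t) powr (-\<epsilon>))"
proof -
  obtain T where T: "T \<ge> exp U"
    and le: "\<And>s t. s \<ge> T \<Longrightarrow> t \<ge> T \<Longrightarrow> \<bar>ln (f s / f t) + \<theta> * ln (s / t)\<bar> \<le> \<epsilon> * \<bar>ln (s / t)\<bar>"
    using ln_ratio_bound[OF assms] by metis
  show thesis
  proof (rule that[OF T])
    fix s t assume st: "s \<ge> T" "t \<ge> T"
    with T exp_U_ge_1 have pos: "s > 0" "t > 0" by linarith+
    have fpos: "f s > 0" "f t > 0" using st T by (auto intro!: f_pos)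
    have "f s / f t = exp (ln (f s / f t))" using fpos by simp
    also have "\<dots> \<le> exp (-\<theta> * ln (s / t) + \<epsilon> * \<bar>ln (s / t)\<bar>)"
      using le[OF st] by simp
    also have "\<dots> = exp (-\<theta> * ln (s / t)) * exp (\<epsilon> * \<bar>ln (s / t)\<bar>)"
      by (rule exp_add)
    also have "\<dots> \<le> exp (-\<theta> * ln (s / t)) * (exp (\<epsilon> * ln (s / t)) + exp (-\<epsilon> * ln (s / t)))"
      by (intro mult_left_mono) (auto simp: abs_if)
    finally show "f s / f t \<le> (s / t) powr (-\<theta>) * ((s / t) powr \<epsilon> + (s / t) powr (-\<epsilon>))"
      using pos by (simp add: powr_def)
  qed
qed

text \<open>Since \<open>ln (p X / q X)\<close> stays bounded, the error in
  \<open>ln_ratio_bound\<close> becomes arbitrarily small. Both arguments move because the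
  applications compare \<open>f (real (N X))\<close> with \<open>f X\<close>, where
  \<open>real (N X) / X\<close> merely converges.\<close>

lemma tendsto_ratio:
  assumes p: "filterlim p at_top F" and q: "filterlim q at_top F"
    and c: "((\<lambda>X. p X / q X) \<longlongrightarrow> c) F" "c > 0"
  shows "((\<lambda>X. f (p X) / f (q X)) \<longlongrightarrow> c powr (-\<theta>)) F"
proof -
  have lnc: "((\<lambda>X. ln (p X / q X)) \<longlongrightarrow> ln c) F"
    using c by (intro tendsto_ln) auto
  have "((\<lambda>X. ln (f (p X) / f (q X)) + \<theta> * ln (p X / q X)) \<longlongrightarrow> 0) F"
  proof (rule tendstoI)
    fix e :: real assume e: "e > 0"
    \<comment> \<open>Eventually \<open>\<bar>ln (p X / q X)\<bar> < \<bar>ln c\<bar> + 1\<close>,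
      so this choice makes the total error less than \<open>e\<close>.\<close>
    define \<epsilon> where "\<epsilon> = e / (\<bar>ln c\<bar> + 1)"
    have \<epsilon>: "\<epsilon> > 0" using e by (simp add: \<epsilon>_def add_nonneg_pos)
    obtain T where
      T: "\<And>s t. s \<ge> T \<Longrightarrow> t \<ge> T \<Longrightarrow> \<bar>ln (f s / f t) + \<theta> * ln (s / t)\<bar> \<le> \<epsilon> * \<bar>ln (s / t)\<bar>"
      using ln_ratio_bound[OF \<epsilon>] by metis
    have "\<forall>\<^sub>F X in F. \<bar>ln (p X / q X)\<bar> < \<bar>ln c\<bar> + 1"
      by (rule order_tendstoD(2)[OF tendsto_rabs[OF lnc]]) simp
    moreover have "\<forall>\<^sub>F X in F. p X \<ge> T" "\<forall>\<^sub>F X in F. q X \<ge> T"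
      using p q by (auto simp: filterlim_at_top)
    ultimately show "\<forall>\<^sub>F X in F. dist (ln (f (p X) / f (q X)) + \<theta> * ln (p X / q X)) 0 < e"
    proof eventually_elim
      case (elim X)
      have "\<bar>ln (f (p X) / f (q X)) + \<theta> * ln (p X / q X)\<bar> \<le> \<epsilon> * \<bar>ln (p X / q X)\<bar>"
        using T elim by blast
      also have "\<dots> < \<epsilon> * (\<bar>ln c\<bar> + 1)"
        using elim \<epsilon> by (intro mult_strict_left_mono)
      also have "\<dots> = e" by (simp add: \<epsilon>_def add_nonneg_eq_0_iff)
      finally show ?case by simp
    qed
  qed
  from tendsto_exp[OF tendsto_diff[OF this tendsto_mult[OF tendsto_const[of \<theta>] lnc]]]
  have "((\<lambda>X. exp (ln (f (p X) / f (q X)))) \<longlongrightarrow> exp (- \<theta> * ln c)) F"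
    by simp
  moreover have "\<forall>\<^sub>F X in F. exp (ln (f (p X) / f (q X))) = f (p X) / f (q X)"
    using eventually_compose_filterlim[OF eventually_f_pos p] eventually_compose_filterlim[OF eventually_f_pos q]
    by eventually_elim simp
  ultimately show ?thesis using c by (simp add: powr_def tendsto_cong)
qed

lemma tendsto_0:
  assumes "\<theta> > 0"
  shows "(f \<longlongrightarrow> 0) at_top"
proof -
  obtain T where T: "T \<ge> exp U"
    and le: "\<And>s t. s \<ge> T \<Longrightarrow> t \<ge> T \<Longrightarrow>
      f s / f t \<le> (s / t) powr (-\<theta>) * ((s / t) powr (\<theta> / 2) + (s / t) powr (-(\<theta> / 2)))"
    using Potter_bound[of "\<theta> / 2"] assms by auto
  have T0: "T > 0" using T exp_U_ge_1 by linarith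
  have lim: "filterlim (\<lambda>t. t / T) at_top at_top"
    unfolding divide_inverse
    by (rule filterlim_at_top_mult_tendsto_pos[OF tendsto_const _ filterlim_ident]) (use T0 in simp)
  show ?thesis
  proof (rule Lim_null_comparison)
    show "\<forall>\<^sub>F t in at_top. norm (f t) \<le>
        f T * ((t / T) powr (-\<theta>) * ((t / T) powr (\<theta> / 2) + (t / T) powr (-(\<theta> / 2))))"
      using eventually_ge_at_top[of T]
    proof eventually_elim
      case (elim t)
      then show ?case using le[of t T] f_pos[of t] f_pos[of T] T by (simp add: field_simps)
    qed
    have "((\<lambda>t. f T * ((t / T) powr (\<theta> / 2 - \<theta>) + (t / T) powr (-(\<theta> / 2) - \<theta>))) \<longlongrightarrow> f T * (0 + 0)) at_top"
      using assms by (intro tendsto_mult tendsto_add tendsto_const tendsto_neg_powr lim) auto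
    then show "((\<lambda>t. f T * ((t / T) powr (-\<theta>) * ((t / T) powr (\<theta> / 2) + (t / T) powr (-(\<theta> / 2))))) \<longlongrightarrow> 0) at_top"
      by (simp add: distrib_left powr_add[symmetric] algebra_simps)
  qed
qed

text \<open>Says that \<open>X * f X\<close>, the size of the whole series, dominates
  \<open>1 / X\<close>. As \<open>f X\<close> is roughly \<open>X powr (-\<theta>)\<close>, this
  needs \<open>\<theta> < 2\<close>; taking \<epsilon> as half the gap keeps both exponents of the
  majorant negative.\<close>

lemma inverse_square_mult_tendsto_0:
  assumes "\<theta> < 2"
  shows "((\<lambda>X. 1 / (X\<^sup>2 * f X)) \<longlongrightarrow> 0) at_top"
proof -
  define \<epsilon> where "\<epsilon> = (2 - \<theta>) / 2"
  have \<epsilon>: "\<epsilon> > 0" using assms by (simp add: \<epsilon>_def)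
  obtain T where T: "T \<ge> exp U"
    and le: "\<And>s t. s \<ge> T \<Longrightarrow> t \<ge> T \<Longrightarrow>
      f s / f t \<le> (s / t) powr (-\<theta>) * ((s / t) powr \<epsilon> + (s / t) powr (-\<epsilon>))"
    using Potter_bound[OF \<epsilon>] by metis
  have T0: "T > 0" using T exp_U_ge_1 by linarith
  define K where "K = T powr (-\<theta> + \<epsilon>) / f T"
  define L where "L = T powr (-\<theta> - \<epsilon>) / f T"
  show ?thesis
  proof (rule Lim_null_comparison)
    show "\<forall>\<^sub>F X in at_top. norm (1 / (X\<^sup>2 * f X)) \<le> K * X powr (\<theta> - \<epsilon> - 2) + L * X powr (\<theta> + \<epsilon> - 2)"
      using eventually_ge_at_top[of T]
    proof eventually_elim
      case (elim X)
      have X: "X > 0" using elim T0 by simp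
      have fp: "f X > 0" "f T > 0" using elim T by (auto intro!: f_pos)
      have "norm (1 / (X\<^sup>2 * f X)) = (f T / f X) * X powr (-2) / f T"
        using fp X by (simp add: powr_minus field_simps)
      also have "\<dots> \<le> (T / X) powr (-\<theta>) * ((T / X) powr \<epsilon> + (T / X) powr (-\<epsilon>)) * X powr (-2) / f T"
        using fp le[of T X] elim by (intro divide_right_mono mult_right_mono) auto
      also have "\<dots> = K * X powr (\<theta> - \<epsilon> - 2) + L * X powr (\<theta> + \<epsilon> - 2)"
      proof -
        have *: "(T / X) powr a * X powr (-2) = T powr a * X powr (-a - 2)" for a
        proof -
          have "(T / X) powr a = T powr a * X powr (-a)"
            using T0 X by (simp add: powr_divide powr_minus_divide)
          then show ?thesis by (simp add: powr_add[symmetric] mult.assoc)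
        qed
        have "(T / X) powr (-\<theta>) * ((T / X) powr \<epsilon> + (T / X) powr (-\<epsilon>)) * X powr (-2) =
            (T / X) powr (-\<theta> + \<epsilon>) * X powr (-2) + (T / X) powr (-\<theta> - \<epsilon>) * X powr (-2)"
          using powr_add[of "T / X" "-\<theta>" \<epsilon>] powr_add[of "T / X" "-\<theta>" "-\<epsilon>"]
          by (simp only: distrib_left distrib_right diff_conv_add_uminus)
        then show ?thesis unfolding * by (simp add: K_def L_def add_divide_distrib add.commute[of \<epsilon>])
      qed
      finally show ?case .
    qed
    have "((\<lambda>X. K * X powr (\<theta> - \<epsilon> - 2) + L * X powr (\<theta> + \<epsilon> - 2)) \<longlongrightarrow> K * 0 + L * 0) at_top"
      using assms \<epsilon>
      by (intro tendsto_mult tendsto_add tendsto_const tendsto_neg_powr filterlim_ident)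
        (auto simp: \<epsilon>_def field_simps)
    then show "((\<lambda>X. K * X powr (\<theta> - \<epsilon> - 2) + L * X powr (\<theta> + \<epsilon> - 2)) \<longlongrightarrow> 0) at_top"
      by simp
  qed
qed

text \<open>Any finite set of terms is \<open>O(1 / X)\<close> by
  \<open>\<bar>sin y\<bar> \<le> \<bar>y\<bar>\<close>. This disposes of the indices at which
  nothing is known about \<open>f\<close>, and of the start of the series at 2 instead of 0.\<close>

lemma finite_sine_sum_negligible:
  assumes "\<theta> < 2" "finite A"
  shows "((\<lambda>X. (\<Sum>n\<in>A. a n * sin (real n / X)) / (X * f X)) \<longlongrightarrow> 0) at_top"
proof (rule Lim_null_comparison)
  show "\<forall>\<^sub>F X in at_top. norm ((\<Sum>n\<in>A. a n * sin (real n / X)) / (X * f X)) \<le>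
      (\<Sum>n\<in>A. \<bar>a n\<bar> * real n) * (1 / (X\<^sup>2 * f X))"
    using eventually_f_pos eventually_gt_at_top[of 0]
  proof eventually_elim
    case (elim X)
    have "\<bar>\<Sum>n\<in>A. a n * sin (real n / X)\<bar> \<le> (\<Sum>n\<in>A. \<bar>a n\<bar> * \<bar>real n / X\<bar>)"
      by (intro order_trans[OF sum_abs] sum_mono, unfold abs_mult)
        (intro mult_left_mono abs_sin_x_le_abs_x abs_ge_zero)
    also have "\<dots> = (\<Sum>n\<in>A. \<bar>a n\<bar> * real n) / X"
      using elim by (simp add: sum_divide_distrib)
    finally have "\<bar>\<Sum>n\<in>A. a n * sin (real n / X)\<bar> / (X * f X) \<le> (\<Sum>n\<in>A. \<bar>a n\<bar> * real n) / X / (X * f X)"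
      using elim by (intro divide_right_mono) auto
    with elim show ?case by (simp add: power2_eq_square mult_ac abs_mult)
  qed
  show "((\<lambda>X. (\<Sum>n\<in>A. \<bar>a n\<bar> * real n) * (1 / (X\<^sup>2 * f X))) \<longlongrightarrow> 0) at_top"
    using inverse_square_mult_tendsto_0[OF assms(1)] by (rule tendsto_mult_right_zero)
qed

lemma eventually_antimono:
  assumes "\<forall>\<^sub>F u in at_top. h u \<le> 0"
  obtains T where "T \<ge> exp U" "antimono_on {T..} f"
proof -
  from assms obtain V0 where V0: "\<And>u. u \<ge> V0 \<Longrightarrow> h u \<le> 0"
    by (auto simp: eventually_at_top_linorder)
  define V where "V = max U V0"
  have T: "exp V \<ge> exp U" by (simp add: V_def)
  show thesis
  proof (rule that[OF T])
    show "antimono_on {exp V..} f"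
    proof (intro monotone_onI)
      fix s t assume st: "s \<in> {exp V..}" "t \<in> {exp V..}" "s \<le> t"
      then have pos: "s > 0" by (auto intro: less_le_trans[OF exp_gt_zero])
      have "ln s \<ge> V" using st pos by (simp add: ln_ge_iff)
      have "\<phi> (ln t) \<le> \<phi> (ln s)"
      proof (rule DERIV_nonpos_imp_nonincreasing[of "ln s" "ln t" \<phi>])
        show "ln s \<le> ln t" using st pos by simp
        fix u assume "ln s \<le> u" "u \<le> ln t"
        with \<open>ln s \<ge> V\<close> have "u \<ge> U" "u \<ge> V0" by (auto simp: V_def)
        then show "\<exists>y. (\<phi> has_real_derivative y) (at u) \<and> y \<le> 0"
          using deriv V0 by blast
      qed
      moreover have "s \<ge> exp U" "t \<ge> exp U" using st T unfolding atLeast_iff by linarith+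
      ultimately show "f t \<le> f s" by (simp add: f_eq)
    qed
  qed
qed

end

section \<open>Exponent between 0 and 2\<close>

lemma sin_half_ge:
  fixes y :: real
  assumes "0 \<le> y" "y \<le> 1"
  shows "y / 2 \<le> sin y"
proof -
  have "sin 0 - 0 / 2 \<le> sin y - y / 2"
  proof (rule DERIV_nonneg_imp_nondecreasing[of 0 y "\<lambda>y. sin y - y / 2"])
    fix z assume z: "0 \<le> z" "z \<le> y"
    have "cos (pi / 3) \<le> cos z"
      using z assms pi_gt3 by (intro cos_monotone_0_pi_le) auto
    then have "0 \<le> cos z - 1 / 2" by (simp add: cos_60)
    moreover have "((\<lambda>y. sin y - y / 2) has_real_derivative cos z - 1 / 2) (at z)"
      by (auto intro!: derivative_eq_intros)
    ultimately show "\<exists>d. ((\<lambda>y. sin y - y / 2) has_real_derivative d) (at z) \<and> 0 \<le> d" by blast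
  qed (use assms in simp)
  then show ?thesis by simp
qed

text \<open>With \<open>x = 1 / X\<close> this controls the factor
  \<open>1 / \<bar>sin (x / 2)\<bar>\<close> of Dirichlet's test; the constants 4 and 8 in the tail
  estimates come from here.\<close>

lemma inverse_sin_le:
  fixes X :: real
  assumes "X \<ge> 1"
  shows "sin (1 / X / 2) > 0" "1 / \<bar>sin (1 / X / 2)\<bar> \<le> 4 * X"
proof -
  have "1 / X / 2 / 2 \<le> sin (1 / X / 2)" using assms by (intro sin_half_ge) (auto simp: field_simps)
  moreover have "1 / X / 2 / 2 > 0" using assms by simp
  ultimately show pos: "sin (1 / X / 2) > 0" by linarith
  have "1 / (4 * X) \<le> sin (1 / X / 2)" using \<open>1 / X / 2 / 2 \<le> _\<close> by (simp add: field_simps)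
  then show "1 / \<bar>sin (1 / X / 2)\<bar> \<le> 4 * X" using pos assms by (simp add: field_simps)
qed

text \<open>The intervals are disjoint, and \<open>t\<close> lies in the one whose index is the
  ceiling of \<open>t * X\<close>, so a sum over \<open>n\<close> becomes a function of
  \<open>t\<close> to which dominated convergence applies. The condition \<open>m \<ge> 1\<close>
  keeps out the index 0, to which \<open>nat\<close> also maps negative ceilings.\<close>

lemma step_function_eq:
  fixes g :: "nat \<Rightarrow> real"
  assumes "X > 0" "m \<ge> 1"
  shows "(\<Sum>n=m..N. indicator {(real n - 1) / X<..real n / X} t * g n) =
    (if m \<le> nat \<lceil>t * X\<rceil> \<and> nat \<lceil>t * X\<rceil> \<le> N then g (nat \<lceil>t * X\<rceil>) else 0)"
proof -
  have "indicator {(real n - 1) / X<..real n / X} t * g n = (if n = nat \<lceil>t * X\<rceil> then g n else 0)"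
    if "n \<in> {m..N}" for n
  proof -
    have "t \<in> {(real n - 1) / X<..real n / X} \<longleftrightarrow> \<lceil>t * X\<rceil> = int n"
      using assms by (simp add: ceiling_eq_iff field_simps)
    also have "\<dots> \<longleftrightarrow> n = nat \<lceil>t * X\<rceil>" using that assms by auto
    finally show ?thesis by (simp add: indicator_def)
  qed
  then have "(\<Sum>n=m..N. indicator {(real n - 1) / X<..real n / X} t * g n) =
      (\<Sum>n=m..N. if n = nat \<lceil>t * X\<rceil> then g n else 0)"
    by (intro sum.cong) auto
  then show ?thesis by (simp add: sum.delta)
qed

lemma integral_step_function:
  fixes g :: "nat \<Rightarrow> real"
  assumes "X > 0"
  shows "(LBINT t. (\<Sum>n=m..N. indicator {(real n - 1) / X<..real n / X} t * g n)) = (\<Sum>n=m..N. g n) / X"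
proof -
  have "has_bochner_integral lborel (\<lambda>t. \<Sum>n=m..N. indicator {(real n - 1) / X<..real n / X} t * g n)
     (\<Sum>n=m..N. 1 / X * g n)"
  proof (intro has_bochner_integral_sum has_bochner_integral_mult_left)
    fix n
    have "real n / X - (real n - 1) / X = 1 / X" by (simp add: diff_divide_distrib[symmetric])
    moreover have "(real n - 1) / X \<le> real n / X" using assms by (simp add: divide_right_mono)
    ultimately show "has_bochner_integral lborel (indicator {(real n - 1) / X<..real n / X}) (1 / X)"
      using has_bochner_integral_real_indicator[of "{(real n - 1) / X<..real n / X}" lborel]
      using assms by (simp add: measure_def)
  qed
  then show ?thesis by (simp add: has_bochner_integral_integral_eq sum_divide_distrib)
qed

lemma filterlim_nat_floor_mult:
  assumes "A > 0"
  shows "filterlim (\<lambda>X. real (nat \<lfloor>A * X\<rfloor>)) at_top at_top"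
    and "((\<lambda>X. real (nat \<lfloor>A * X\<rfloor>) / X) \<longlongrightarrow> A) at_top"
proof -
  have le: "\<forall>\<^sub>F X in at_top. A - 1 / X \<le> real (nat \<lfloor>A * X\<rfloor>) / X"
    using eventually_gt_at_top[of 0]
  proof eventually_elim
    case (elim X)
    have "A * X - 1 \<le> real (nat \<lfloor>A * X\<rfloor>)" by linarith
    then have "(A * X - 1) / X \<le> real (nat \<lfloor>A * X\<rfloor>) / X" using elim by (intro divide_right_mono) auto
    then show ?case using elim by (simp add: diff_divide_distrib)
  qed
  have ge: "\<forall>\<^sub>F X in at_top. real (nat \<lfloor>A * X\<rfloor>) / X \<le> A"
    using eventually_gt_at_top[of 0]
  proof eventually_elim
    case (elim X)
    have "A * X \<ge> 0" using assms elim by simp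
    then have "real (nat \<lfloor>A * X\<rfloor>) \<le> A * X" by linarith
    then show ?case using elim by (simp add: field_simps)
  qed
  have "((\<lambda>X. A - 1 / X) \<longlongrightarrow> A - 0) at_top"
    by (intro tendsto_diff tendsto_const tendsto_divide_0[OF tendsto_const]
        filterlim_at_top_imp_at_infinity filterlim_ident)
  then show "((\<lambda>X. real (nat \<lfloor>A * X\<rfloor>) / X) \<longlongrightarrow> A) at_top"
    using tendsto_sandwich[OF le ge] by simp
  show "filterlim (\<lambda>X. real (nat \<lfloor>A * X\<rfloor>)) at_top at_top"
  proof (rule filterlim_at_top_mono)
    show "filterlim (\<lambda>X. -1 + A * X) at_top at_top"
      using assms by (intro filterlim_tendsto_add_at_top[OF tendsto_const]
          filterlim_tendsto_pos_mult_at_top[OF tendsto_const _ filterlim_ident])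
    show "\<forall>\<^sub>F X in at_top. -1 + A * X \<le> real (nat \<lfloor>A * X\<rfloor>)"
      by (intro always_eventually allI) linarith
  qed
qed

lemma suminf_split_three:
  fixes F :: "nat \<Rightarrow> real"
  assumes "summable F" "m \<le> N"
  shows "suminf F = (\<Sum>n<m. F n) + (\<Sum>n=m..<N. F n) + (\<Sum>k. F (k + N))"
proof -
  have "(\<Sum>n<N. F n) = (\<Sum>n<m. F n) + (\<Sum>n=m..<N. F n)"
    using assms(2) by (simp add: sum.atLeastLessThan_concat lessThan_atLeast0)
  then show ?thesis using suminf_split_initial_segment[OF assms(1), of N] by simp
qed

section \<open>Head and tail of the series; the limit for positive \<theta>\<close>

context regularly_varying
begin

text \<open>The normalised sum is the integral of the step function \<open>\<psi> X\<close>. Its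
  pointwise limit on \<open>(0, A)\<close> comes from \<open>tendsto_ratio\<close>, its majorant
  from Potter's bound. The threshold \<open>T\<close> is fixed before \<open>m\<close> so that
  \<open>m\<close> can be taken beyond other thresholds as well.\<close>

lemma head_tendsto_integral:
  assumes \<theta>: "0 < \<theta>" "\<theta> < 2" and A: "A > 0"
  obtains T where "\<And>m. real m \<ge> T \<Longrightarrow>
    ((\<lambda>X. (\<Sum>n=m..nat \<lfloor>A * X\<rfloor>. f n * sin (real n / X)) / (X * f X))
       \<longlongrightarrow> (LBINT t:{0<..<A}. t powr (-\<theta>) * sin t)) at_top"
proof -
  \<comment> \<open>After multiplication by \<open>\<bar>sin y\<bar> \<le> y\<close> the worse
    exponent at 0 is \<open>-\<theta> - \<epsilon> + 1\<close>; this choice makes it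
    \<open>-(\<theta> / 2)\<close>, which is integrable because \<open>\<theta> < 2\<close>.\<close>
  define \<epsilon> where "\<epsilon> = 1 - \<theta> / 2"
  have \<epsilon>: "\<epsilon> > 0" using \<theta> by (simp add: \<epsilon>_def)
  obtain T where T: "T \<ge> exp U"
    and le: "\<And>s t. s \<ge> T \<Longrightarrow> t \<ge> T \<Longrightarrow>
      f s / f t \<le> (s / t) powr (-\<theta>) * ((s / t) powr \<epsilon> + (s / t) powr (-\<epsilon>))"
    using Potter_bound[OF \<epsilon>] by metis
  have T1: "T \<ge> 1" using T exp_U_ge_1 by linarith
  show thesis
  proof (rule that)
    fix m :: nat assume m: "real m \<ge> T"
    then have m1: "m \<ge> 1" using T1 by linarith
    define N where "N = (\<lambda>X. nat \<lfloor>A * X\<rfloor>)"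
    define g where "g = (\<lambda>X n. f (real n) / f X * sin (real n / X))"
    define \<psi> where "\<psi> = (\<lambda>X t. \<Sum>n=m..N X. indicator {(real n - 1) / X<..real n / X} t * g X n)"
    define C where "C = 1 + A powr (2 * \<epsilon>)"
    have \<psi>_eq: "\<psi> X t = (if m \<le> nat \<lceil>t * X\<rceil> \<and> nat \<lceil>t * X\<rceil> \<le> N X then g X (nat \<lceil>t * X\<rceil>) else 0)"
      if "X > 0" for X t
      unfolding \<psi>_def using step_function_eq[OF that m1] .
    have g_bound: "\<bar>g X n\<bar> \<le> C * (real n / X) powr (-(\<theta> / 2))"
      if X: "X \<ge> T" and n: "m \<le> n" "n \<le> N X" for X n
    proof -
      define y where "y = real n / X"
      have pos: "X > 0" "real n > 0" "real n \<ge> T" using X T1 n m m1 by auto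
      then have y: "y > 0" by (simp add: y_def)
      have "real n \<le> A * X" using n A pos unfolding N_def by (simp add: le_nat_iff le_floor_iff)
      then have yA: "y \<le> A" using pos by (simp add: y_def field_simps)
      have fp: "f X > 0" "f n > 0" using pos X T by (auto intro!: f_pos)
      have "\<bar>g X n\<bar> \<le> f n / f X * y"
        unfolding g_def abs_mult y_def[symmetric] using fp abs_sin_x_le_abs_x[of y] y
        by (intro mult_mono) auto
      also have "\<dots> \<le> y powr (-\<theta>) * (y powr \<epsilon> + y powr (-\<epsilon>)) * y"
        using le[of n X] pos X y unfolding y_def by (intro mult_right_mono) auto
      also have "\<dots> = (1 + y powr (2 * \<epsilon>)) * y powr (-(\<theta> / 2))"
      proof -
        have "y powr (-\<theta>) * (y powr \<epsilon> + y powr (-\<epsilon>)) * y =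
            y powr (-\<theta>) * (y powr \<epsilon> + y powr (-\<epsilon>)) * y powr 1" using y by simp
        also have "\<dots> = y powr (-\<theta> + \<epsilon> + 1) + y powr (-\<theta> + -\<epsilon> + 1)"
          by (simp only: powr_add distrib_left distrib_right)
        also have "-\<theta> + \<epsilon> + 1 = 2 * \<epsilon> + -(\<theta> / 2)" by (simp add: \<epsilon>_def)
        also have "-\<theta> + -\<epsilon> + 1 = -(\<theta> / 2)" by (simp add: \<epsilon>_def)
        finally show ?thesis by (simp only: powr_add distrib_right mult_1)
      qed
      also have "\<dots> \<le> C * y powr (-(\<theta> / 2))"
        unfolding C_def using y yA \<epsilon> by (intro mult_right_mono add_left_mono powr_mono2) auto
      finally show ?thesis by (simp add: y_def)
    qed
    have C0: "C \<ge> 0" by (simp add: C_def)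
    have "((\<lambda>X. LBINT t. \<psi> X t) \<longlongrightarrow> (LBINT t. indicator {0<..<A} t * (t powr (-\<theta>) * sin t))) at_top"
    proof (rule integral_dominated_convergence_at_top)
      show "(\<lambda>t. indicator {0<..<A} t * (t powr (-\<theta>) * sin t)) \<in> borel_measurable lborel" by simp
      show "\<psi> X \<in> borel_measurable lborel" for X unfolding \<psi>_def by measurable
      \<comment> \<open>The range extends to \<open>A + 1\<close> because \<open>\<psi> X\<close>
        may be nonzero at \<open>t = A\<close>, which an open interval ending at \<open>A\<close>
        would miss.\<close>
      show "integrable lborel (\<lambda>t. C * (indicator {0<..<A + 1} t * t powr (-(\<theta> / 2))))"
        using set_integrable_powr_from_0[of "-(\<theta> / 2)" "A + 1"] \<theta>
        by (simp add: set_integrable_def)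
      show "\<forall>\<^sub>F X in at_top. AE t in lborel. norm (\<psi> X t) \<le> C * (indicator {0<..<A + 1} t * t powr (-(\<theta> / 2)))"
        using eventually_ge_at_top[of T]
      proof eventually_elim
        case (elim X)
        then have X: "X > 0" using T1 by linarith
        have "norm (\<psi> X t) \<le> C * (indicator {0<..<A + 1} t * t powr (-(\<theta> / 2)))" for t
        proof (cases "m \<le> nat \<lceil>t * X\<rceil> \<and> nat \<lceil>t * X\<rceil> \<le> N X")
          case True
          define n where "n = nat \<lceil>t * X\<rceil>"
          have n: "m \<le> n" "n \<le> N X" using True by (auto simp: n_def)
          have "0 < \<lceil>t * X\<rceil>" using n m1 unfolding n_def by linarith
          then have "t * X > 0" by simp
          then have t: "t > 0" using X by (simp add: zero_less_mult_iff)
          have "t * X \<le> real n" unfolding n_def by linarith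
          then have tn: "t \<le> real n / X" using X by (simp add: field_simps)
          have "real n \<le> A * X" using n A X unfolding N_def by (simp add: le_nat_iff le_floor_iff)
          then have nA: "real n / X \<le> A" using X by (simp add: field_simps)
          have "norm (\<psi> X t) = \<bar>g X n\<bar>" using \<psi>_eq[OF X] True by (simp add: n_def)
          also have "\<dots> \<le> C * (real n / X) powr (-(\<theta> / 2))"
            using g_bound elim n by blast
          also have "\<dots> \<le> C * t powr (-(\<theta> / 2))"
            using t tn \<theta> C0 by (intro mult_left_mono powr_mono2') auto
          finally show ?thesis using t tn nA by simp
        next
          case False
          then have "\<psi> X t = 0" using \<psi>_eq[OF X] by auto
          then show ?thesis using C0 by simp
        qed
        then show ?case by simp
      qed
      \<comment> \<open>At \<open>t = A\<close> rounding decides whether the term is cut off, so the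
        pointwise limit can fail there; one point is a null set.\<close>
      show "AE t in lborel. ((\<lambda>X. \<psi> X t) \<longlongrightarrow> indicator {0<..<A} t * (t powr (-\<theta>) * sin t)) at_top"
        using AE_lborel_singleton[of A]
      proof eventually_elim
        case (elim t)
        consider "t \<le> 0" | "t > A" | "0 < t" "t < A" using elim by linarith
        then show ?case
        proof cases
          case 1
          have "\<forall>\<^sub>F X in at_top. \<psi> X t = 0"
            using eventually_gt_at_top[of 0]
          proof eventually_elim
            case (elim X)
            have "t * X \<le> 0" using 1 elim by (simp add: mult_le_0_iff)
            then have "nat \<lceil>t * X\<rceil> = 0" by simp
            then show ?case using \<psi>_eq[OF elim] m1 by simp
          qed
          then show ?thesis using 1 by (simp add: tendsto_eventually)
        next
          case 2
          have "\<forall>\<^sub>F X in at_top. \<psi> X t = 0"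
            using eventually_gt_at_top[of 0]
          proof eventually_elim
            case (elim X)
            have "real (N X) \<le> A * X" using A elim by (simp add: N_def)
            also have "\<dots> < t * X" using 2 elim by simp
            also have "\<dots> \<le> real (nat \<lceil>t * X\<rceil>)" by linarith
            finally have "\<not> nat \<lceil>t * X\<rceil> \<le> N X" by linarith
            then show ?case using \<psi>_eq[OF elim] by simp
          qed
          then show ?thesis using 2 by (simp add: tendsto_eventually)
        next
          case 3
          define n where "n = (\<lambda>X. nat \<lceil>t * X\<rceil>)"
          have n_lim: "filterlim (\<lambda>X. real (n X)) at_top at_top"
          proof (rule filterlim_at_top_mono)
            show "filterlim (\<lambda>X. t * X) at_top at_top"
              using 3 by (intro filterlim_tendsto_pos_mult_at_top[OF tendsto_const _ filterlim_ident])
            show "\<forall>\<^sub>F X in at_top. t * X \<le> real (n X)"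
              unfolding n_def by (intro always_eventually allI) linarith
          qed
          have nX: "((\<lambda>X. real (n X) / X) \<longlongrightarrow> t) at_top"
          proof (rule tendsto_sandwich)
            show "\<forall>\<^sub>F X in at_top. t \<le> real (n X) / X"
              using eventually_gt_at_top[of 0]
            proof eventually_elim
              case (elim X)
              have "t * X \<le> real (n X)" unfolding n_def by linarith
              then show ?case using elim by (simp add: field_simps)
            qed
            show "\<forall>\<^sub>F X in at_top. real (n X) / X \<le> t + 1 / X"
              using eventually_gt_at_top[of 0]
            proof eventually_elim
              case (elim X)
              have "t * X \<ge> 0" using elim 3 by simp
              then have "real (n X) \<le> t * X + 1" unfolding n_def by linarith
              then show ?case using elim by (simp add: field_simps)
            qed
            have "((\<lambda>X. t + 1 / X) \<longlongrightarrow> t + 0) at_top"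
              by (intro tendsto_add tendsto_const tendsto_divide_0[OF tendsto_const] filterlim_at_top_imp_at_infinity filterlim_ident)
            then show "((\<lambda>X. t + 1 / X) \<longlongrightarrow> t) at_top" by simp
          qed simp
          have "((\<lambda>X. g X (n X)) \<longlongrightarrow> t powr (-\<theta>) * sin t) at_top"
            unfolding g_def using 3
            by (intro tendsto_mult tendsto_sin nX tendsto_ratio n_lim filterlim_ident)
          moreover have "\<forall>\<^sub>F X in at_top. g X (n X) = \<psi> X t"
          proof -
            have "\<forall>\<^sub>F X in at_top. real (n X) \<ge> real m" using n_lim unfolding filterlim_at_top by blast
            moreover have "\<forall>\<^sub>F X in at_top. real (n X) / X < A"
              using nX 3 by (intro order_tendstoD(2))
            ultimately show ?thesis using eventually_gt_at_top[of 0]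
            proof eventually_elim
              case (elim X)
              have "real (n X) < A * X" using elim by (simp add: field_simps)
              then have "n X \<le> N X" unfolding N_def using A elim by (simp add: le_nat_iff le_floor_iff)
              then show ?case using \<psi>_eq[OF elim(3), of t] elim by (simp add: n_def)
            qed
          qed
          ultimately show ?thesis using 3 by (simp add: tendsto_cong)
        qed
      qed
    qed
    moreover have "\<forall>\<^sub>F X in at_top. (LBINT t. \<psi> X t) =
        (\<Sum>n=m..nat \<lfloor>A * X\<rfloor>. f n * sin (real n / X)) / (X * f X)"
      using eventually_gt_at_top[of 0]
    proof eventually_elim
      case (elim X)
      show ?case unfolding \<psi>_def integral_step_function[OF elim] g_def N_def
        by (simp add: sum_divide_distrib mult.commute)
    qed
    ultimately show "((\<lambda>X. (\<Sum>n=m..nat \<lfloor>A * X\<rfloor>. f n * sin (real n / X)) / (X * f X))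
       \<longlongrightarrow> (LBINT t:{0<..<A}. t powr (-\<theta>) * sin t)) at_top"
      by (simp add: tendsto_cong set_lebesgue_integral_def)
  qed
qed

lemma
  fixes x :: real
  assumes T: "antimono_on {T..} f" and lim: "(f \<longlongrightarrow> 0) at_top" and m: "real m \<ge> T"
    and x: "sin (x / 2) \<noteq> 0"
  shows summable_sine_tail: "summable (\<lambda>k. f (real (k + m)) * sin (real (k + m) * x))"
    and abs_sine_tail_le: "\<bar>\<Sum>k. f (real (k + m)) * sin (real (k + m) * x)\<bar> \<le> f (real m) / \<bar>sin (x / 2)\<bar>"
proof -
  have dec: "decseq (\<lambda>k. f (real (k + m)))"
    using T m by (auto simp: decseq_def intro!: monotone_onD[OF T])
  have "(\<lambda>n. f (real n)) \<longlonglongrightarrow> 0"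
    using filterlim_compose[OF lim filterlim_real_sequentially] .
  then have "(\<lambda>k. f (real (k + m))) \<longlonglongrightarrow> 0"
    by (rule LIMSEQ_ignore_initial_segment)
  note * = summable_decseq_mult_sin[OF dec this x, of "real m * x"]
    abs_suminf_decseq_mult_sin_le[OF dec this x, of "real m * x"]
  then show "summable (\<lambda>k. f (real (k + m)) * sin (real (k + m) * x))"
    and "\<bar>\<Sum>k. f (real (k + m)) * sin (real (k + m) * x)\<bar> \<le> f (real m) / \<bar>sin (x / 2)\<bar>"
    by (simp_all add: algebra_simps)
qed

lemma summable_sine:
  assumes h: "\<forall>\<^sub>F u in at_top. h u \<le> 0" and lim: "(f \<longlongrightarrow> 0) at_top" and X: "X \<ge> 1"
  shows "summable (\<lambda>n. f (real n) * sin (real n / X))"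
proof -
  obtain T where T: "antimono_on {T..} f" using eventually_antimono[OF h] by metis
  obtain m :: nat where "real m \<ge> T" using real_arch_simple by blast
  from summable_sine_tail[OF T lim this, of "1 / X"] inverse_sin_le(1)[OF X]
  show ?thesis by (subst summable_iff_shift[of _ m, symmetric]) simp
qed

text \<open>The head up to \<open>A * X\<close> tends to the truncated integral. The tail is at most
  \<open>4 * X * f (real (N X + 1))\<close>; divided by \<open>X * f X\<close> this bound tends to
  \<open>4 * A powr (-\<theta>)\<close>, which vanishes for large \<open>A\<close> because
  \<open>\<theta> > 0\<close>.\<close>

lemma sine_series_limit_pos:
  assumes \<theta>: "0 < \<theta>" "\<theta> < 2"
  shows "((\<lambda>X. (\<Sum>n. f (real n) * sin (real n / X)) / (X * f X)) \<longlongrightarrow>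
    pi / (2 * Gamma \<theta> * sin (pi * \<theta> / 2))) at_top"
proof -
  have "\<forall>\<^sub>F u in at_top. h u < 0"
    using h_lim \<theta> by (intro order_tendstoD(2)) auto
  then have h: "\<forall>\<^sub>F u in at_top. h u \<le> 0"
    by eventually_elim simp
  have lim: "(f \<longlongrightarrow> 0) at_top" using tendsto_0 \<theta> by simp
  obtain T1 where T1: "T1 \<ge> exp U" "antimono_on {T1..} f"
    using eventually_antimono[OF h] .
  show ?thesis
  proof (rule tendsto_by_approximation)
    show "((\<lambda>A. LBINT t:{0<..<A}. t powr (-\<theta>) * sin t) \<longlongrightarrow> pi / (2 * Gamma \<theta> * sin (pi * \<theta> / 2))) at_top"
      by (rule tendsto_sin_powr_integral[OF \<theta>])
    have "((\<lambda>A. 4 * A powr (-\<theta>)) \<longlongrightarrow> 4 * 0) at_top"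
      using \<theta> by (intro tendsto_mult tendsto_const tendsto_neg_powr filterlim_ident) auto
    then show "((\<lambda>A. 4 * A powr (-\<theta>)) \<longlongrightarrow> 0) at_top" by simp
    show "\<forall>\<^sub>F A in at_top. \<exists>H r. (H \<longlongrightarrow> (LBINT t:{0<..<A}. t powr (-\<theta>) * sin t)) at_top \<and>
        (r \<longlongrightarrow> 4 * A powr (-\<theta>)) at_top \<and>
        (\<forall>\<^sub>F X in at_top. \<bar>(\<Sum>n. f (real n) * sin (real n / X)) / (X * f X) - H X\<bar> \<le> r X)"
      using eventually_gt_at_top[of 0]
    proof eventually_elim
      case (elim A)
      obtain T2 where T2: "\<And>m. real m \<ge> T2 \<Longrightarrow>
        ((\<lambda>X. (\<Sum>n=m..nat \<lfloor>A * X\<rfloor>. f n * sin (real n / X)) / (X * f X))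
           \<longlongrightarrow> (LBINT t:{0<..<A}. t powr (-\<theta>) * sin t)) at_top"
        by (rule head_tendsto_integral[OF \<theta> elim]) (rule that)
      obtain m :: nat where "real m \<ge> max T1 T2" using real_arch_simple by blast
      then have m: "real m \<ge> T1" "real m \<ge> T2" by auto
      define N where "N = (\<lambda>X. nat \<lfloor>A * X\<rfloor>)"
      define H where "H = (\<lambda>X. (\<Sum>n=m..N X. f n * sin (real n / X)) / (X * f X))"
      define r where "r = (\<lambda>X. \<bar>(\<Sum>n<m. f n * sin (real n / X)) / (X * f X)\<bar> + 4 * (f (real (N X + 1)) / f X))"
      have N: "filterlim (\<lambda>X. real (N X)) at_top at_top" "((\<lambda>X. real (N X) / X) \<longlongrightarrow> A) at_top"
        unfolding N_def using filterlim_nat_floor_mult[OF elim] by auto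
      have "(H \<longlongrightarrow> (LBINT t:{0<..<A}. t powr (-\<theta>) * sin t)) at_top"
        unfolding H_def N_def by (rule T2[OF m(2)])
      moreover have "(r \<longlongrightarrow> 4 * A powr (-\<theta>)) at_top"
      proof -
        have N1: "filterlim (\<lambda>X. real (N X + 1)) at_top at_top"
          using filterlim_tendsto_add_at_top[OF tendsto_const[of 1] N(1)] by (simp add: add.commute)
        have "((\<lambda>X. real (N X) / X + 1 / X) \<longlongrightarrow> A + 0) at_top"
          by (intro tendsto_add N tendsto_divide_0[OF tendsto_const] filterlim_at_top_imp_at_infinity filterlim_ident)
        then have "((\<lambda>X. real (N X + 1) / X) \<longlongrightarrow> A) at_top"
          by (simp add: add_divide_distrib add.commute)
        then have "((\<lambda>X. f (real (N X + 1)) / f X) \<longlongrightarrow> A powr (-\<theta>)) at_top"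
          using elim by (intro tendsto_ratio N1 filterlim_ident)
        then have "(r \<longlongrightarrow> \<bar>0\<bar> + 4 * A powr (-\<theta>)) at_top"
          unfolding r_def using \<theta>
          by (intro tendsto_add tendsto_mult tendsto_rabs tendsto_const finite_sine_sum_negligible) auto
        then show ?thesis by simp
      qed
      moreover have "\<forall>\<^sub>F X in at_top. \<bar>(\<Sum>n. f (real n) * sin (real n / X)) / (X * f X) - H X\<bar> \<le> r X"
      proof -
        have "\<forall>\<^sub>F X in at_top. real (N X) \<ge> real m" using N(1) unfolding filterlim_at_top by blast
        then show ?thesis using eventually_ge_at_top[of 1] eventually_f_pos
        proof eventually_elim
          case (elim X)
          let ?F = "\<lambda>n. f (real n) * sin (real n / X)"
          let ?tail = "\<Sum>k. ?F (k + (N X + 1))"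
          have "{m..<N X + 1} = {m..N X}" by auto
          then have "suminf ?F = (\<Sum>n<m. ?F n) + (\<Sum>n=m..N X. ?F n) + ?tail"
            using suminf_split_three[OF summable_sine[OF h lim, of X], of m "N X + 1"] elim by simp
          then have eq: "suminf ?F / (X * f X) - H X = (\<Sum>n<m. ?F n) / (X * f X) + ?tail / (X * f X)"
            unfolding H_def by (simp only: add_divide_distrib)
          have "\<bar>?tail\<bar> \<le> f (real (N X + 1)) / \<bar>sin (1 / X / 2)\<bar>"
            using abs_sine_tail_le[OF T1(2) lim, of "N X + 1" "1 / X"] elim m inverse_sin_le[of X] by simp
          also have "\<dots> = f (real (N X + 1)) * (1 / \<bar>sin (1 / X / 2)\<bar>)" by simp
          also have "\<dots> \<le> f (real (N X + 1)) * (4 * X)"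
            using elim m T1(1) by (intro mult_left_mono inverse_sin_le less_imp_le[OF f_pos]) auto
          finally have "\<bar>?tail / (X * f X)\<bar> \<le> 4 * (f (real (N X + 1)) / f X)"
            using elim by (simp add: abs_mult field_simps)
          then show ?case unfolding eq r_def by (intro order_trans[OF abs_triangle_ineq]) simp
        qed
      qed
      ultimately show ?case by blast
    qed
  qed simp
qed

end

section \<open>Exponent 0\<close>

context regularly_varying
begin

lemma DERIV_f:
  assumes "t > exp U"
  shows "(f has_real_derivative f t * h (ln t) / t) (at t)"
proof -
  have t: "t > 0" using assms exp_U_ge_1 by linarith
  then have lnt: "ln t \<ge> U" using assms by (simp add: ln_ge_iff)
  have "((\<lambda>t. exp (\<phi> (ln t))) has_real_derivative exp (\<phi> (ln t)) * (h (ln t) * (1 / t))) (at t)"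
    by (rule DERIV_fun_exp[OF DERIV_chain2[OF deriv[OF lnt] DERIV_ln_divide[OF t]]])
  then have "((\<lambda>t. exp (\<phi> (ln t))) has_real_derivative f t * h (ln t) / t) (at t)"
    using assms by (simp add: f_eq)
  moreover have "\<forall>\<^sub>F s in nhds t. s > exp U"
    using assms by (intro eventually_nhds_in_open[of "{exp U<..}", simplified]) auto
  then have "\<forall>\<^sub>F s in nhds t. exp (\<phi> (ln s)) = f s"
    by eventually_elim (simp add: f_eq)
  ultimately show ?thesis by (simp add: DERIV_cong_ev)
qed

text \<open>By \<open>DERIV_f\<close> the function in \<open>mono\<close> is \<open>- f'\<close>, so
  \<open>mono\<close> expresses convexity. The mean value theorem makes the difference an
  intermediate slope. At consecutive points the two bounds together show that the differences
  decrease; the first alone bounds their size.\<close>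

lemma diff_between_slopes:
  assumes T: "T > exp U" and mono: "antimono_on {T..} (\<lambda>t. - f t * h (ln t) / t)" and t: "t \<ge> T"
  shows "f t - f (t + 1) \<le> - f t * h (ln t) / t"
    and "- f (t + 1) * h (ln (t + 1)) / (t + 1) \<le> f t - f (t + 1)"
proof -
  have "\<exists>z. t < z \<and> z < t + 1 \<and> f (t + 1) - f t = (t + 1 - t) * (f z * h (ln z) / z)"
    using t T by (intro MVT2 DERIV_f) auto
  then obtain z where z: "t < z" "z < t + 1" "f t - f (t + 1) = - f z * h (ln z) / z" by auto
  show "f t - f (t + 1) \<le> - f t * h (ln t) / t"
    unfolding z(3) using z t by (intro monotone_onD[OF mono]) auto
  show "- f (t + 1) * h (ln (t + 1)) / (t + 1) \<le> f t - f (t + 1)"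
    unfolding z(3) using z t by (intro monotone_onD[OF mono]) auto
qed

text \<open>The normalised boundary term of the summation by parts tends to
  \<open>cos \<eta>\<close>. The head contributes at most
  \<open>\<eta> * (\<eta>\<^sup>2 + 1)\<close>, and for fixed \<eta> the remaining cosine series is
  of relative order \<open>- h (ln (real (N X)))\<close>, which tends to
  \<open>\<theta> = 0\<close>. Letting \<eta> tend to 0 yields 1.\<close>

lemma sine_series_limit_0:
  assumes \<theta>: "\<theta> = 0" and h: "\<forall>\<^sub>F u in at_top. h u \<le> 0" and lim: "(f \<longlongrightarrow> 0) at_top"
    and T0: "antimono_on {T0..} (\<lambda>t. - f t * h (ln t) / t)"
  shows "((\<lambda>X. (\<Sum>n. f (real n) * sin (real n / X)) / (X * f X)) \<longlongrightarrow> 1) at_top"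
proof -
  obtain T1 where T1: "T1 \<ge> exp U" "antimono_on {T1..} f"
    using eventually_antimono[OF h] .
  \<comment> \<open>With exponent 1 and \<open>\<theta> = 0\<close> the bound is
    \<open>y + 1 / y\<close> for \<open>y = s / t\<close>; in the head the factor
    \<open>\<bar>sin y\<bar> \<le> y\<close> cancels the pole and leaves
    \<open>y\<^sup>2 + 1\<close>.\<close>
  obtain T2 where T2: "T2 \<ge> exp U"
    and le: "\<And>s t. s \<ge> T2 \<Longrightarrow> t \<ge> T2 \<Longrightarrow>
      f s / f t \<le> (s / t) powr (-\<theta>) * ((s / t) powr 1 + (s / t) powr (-1))"
    using Potter_bound[of 1] by (metis zero_less_one)
  \<comment> \<open>The entry \<open>exp U + 1\<close> secures the strict inequality
    \<open>real m > exp U\<close> that differentiating \<open>f\<close> requires.\<close>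
  obtain m :: nat where "real m \<ge> max (max T1 T2) (max T0 (exp U + 1))" using real_arch_simple by blast
  then have m: "real m \<ge> T1" "real m \<ge> T2" "real m \<ge> T0" "real m > exp U" by auto
  then have m1: "m \<ge> 1" using exp_U_ge_1 by linarith
  have mono: "antimono_on {real m..} (\<lambda>t. - f t * h (ln t) / t)"
    by (rule monotone_on_subset[OF T0]) (use m in auto)
  show ?thesis
  proof (rule tendsto_by_approximation)
    have "(cos \<longlongrightarrow> cos 0) (at_right (0::real))" by (intro tendsto_intros)
    then show "(cos \<longlongrightarrow> 1) (at_right (0::real))" by simp
    have "((\<lambda>\<eta>::real. \<eta> * (\<eta>\<^sup>2 + 1)) \<longlongrightarrow> 0 * (0\<^sup>2 + 1)) (at_right 0)"
      by (intro tendsto_intros)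
    then show "((\<lambda>\<eta>::real. \<eta> * (\<eta>\<^sup>2 + 1)) \<longlongrightarrow> 0) (at_right 0)" by simp
    show "\<forall>\<^sub>F \<eta> in at_right (0::real). \<exists>H r. (H \<longlongrightarrow> cos \<eta>) at_top \<and>
        (r \<longlongrightarrow> \<eta> * (\<eta>\<^sup>2 + 1)) at_top \<and>
        (\<forall>\<^sub>F X in at_top. \<bar>(\<Sum>n. f (real n) * sin (real n / X)) / (X * f X) - H X\<bar> \<le> r X)"
      using eventually_at_right_less
    proof eventually_elim
      case (elim \<eta>)
      define N where "N = (\<lambda>X. nat \<lfloor>\<eta> * X\<rfloor>)"
      \<comment> \<open>The boundary term of the summation by parts: its phase is
        \<open>(real (N X) - 1 / 2) / X\<close>, and the denominator tends to 1.\<close>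
      define H where "H = (\<lambda>X. f (real (N X)) / f X * cos (real (N X) / X - 1 / X / 2) / (2 * sin (1 / X / 2) * X))"
      \<comment> \<open>The three parts belong to the terms below \<open>m\<close>, the terms from
        \<open>m\<close> to \<open>N X\<close>, and the cosine series left by the summation by
        parts.\<close>
      define r where "r = (\<lambda>X. \<bar>(\<Sum>n<m. f n * sin (real n / X)) / (X * f X)\<bar> + \<eta> * (\<eta>\<^sup>2 + 1)
        + 8 * (f (real (N X)) / f X * - h (ln (real (N X))) / (real (N X) / X)))"
      have N: "filterlim (\<lambda>X. real (N X)) at_top at_top" "((\<lambda>X. real (N X) / X) \<longlongrightarrow> \<eta>) at_top"
        unfolding N_def using filterlim_nat_floor_mult[OF elim] by auto
      have fN: "((\<lambda>X. f (real (N X)) / f X) \<longlongrightarrow> 1) at_top"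
        using tendsto_ratio[OF N(1) filterlim_ident N(2) elim] \<theta> elim by simp
      have X0: "((\<lambda>X::real. 1 / X / 2) \<longlongrightarrow> 0) at_top" by real_asymp
      have sin2: "((\<lambda>X::real. 2 * sin (1 / X / 2) * X) \<longlongrightarrow> 1) at_top" by real_asymp
      have "(H \<longlongrightarrow> 1 * cos (\<eta> - 0) / 1) at_top"
        unfolding H_def by (intro tendsto_intros fN N X0 sin2) auto
      then have "(H \<longlongrightarrow> cos \<eta>) at_top" by simp
      moreover have "(r \<longlongrightarrow> \<eta> * (\<eta>\<^sup>2 + 1)) at_top"
      proof -
        have "((\<lambda>X. h (ln (real (N X)))) \<longlongrightarrow> -\<theta>) at_top"
          by (rule filterlim_compose[OF h_lim filterlim_compose[OF ln_at_top N(1)]])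
        then have "((\<lambda>X. f (real (N X)) / f X * - h (ln (real (N X))) / (real (N X) / X)) \<longlongrightarrow> 1 * - 0 / \<eta>) at_top"
          using elim \<theta> by (intro tendsto_intros fN N) auto
        then have "(r \<longlongrightarrow> \<bar>0\<bar> + \<eta> * (\<eta>\<^sup>2 + 1) + 8 * (1 * - 0 / \<eta>)) at_top"
          unfolding r_def using \<theta>
          by (intro tendsto_add tendsto_mult tendsto_rabs tendsto_const finite_sine_sum_negligible) auto
        then show ?thesis by simp
      qed
      moreover have "\<forall>\<^sub>F X in at_top. \<bar>(\<Sum>n. f (real n) * sin (real n / X)) / (X * f X) - H X\<bar> \<le> r X"
      proof -
        have "\<forall>\<^sub>F X in at_top. real (N X) \<ge> real m" using N(1) unfolding filterlim_at_top by blast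
        then show ?thesis using eventually_ge_at_top[of "max 1 T2"] eventually_f_pos
        proof eventually_elim
          case (elim X)
          then have X: "X \<ge> 1" "X \<ge> T2" "f X > 0" and mN: "m \<le> N X" by auto
          let ?F = "\<lambda>n. f (real n) * sin (real n / X)"
          let ?tail = "\<Sum>k. ?F (k + N X)"
          let ?c = "\<lambda>k. cos (real (k + N X) / X - 1 / X / 2)"
          let ?\<Delta> = "\<lambda>k. f (real (k + N X)) - f (real (Suc k + N X))"
          let ?s = "sin (1 / X / 2)"
          have s: "?s > 0" "1 / ?s \<le> 4 * X" using inverse_sin_le[OF X(1)] by auto
          have sF: "summable ?F" by (rule summable_sine[OF h lim X(1)])
          have split: "suminf ?F = (\<Sum>n<m. ?F n) + (\<Sum>n=m..<N X. ?F n) + ?tail"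
            by (rule suminf_split_three[OF sF mN])
          have head: "\<bar>(\<Sum>n=m..<N X. ?F n) / (X * f X)\<bar> \<le> \<eta> * (\<eta>\<^sup>2 + 1)"
          proof -
            have NX: "real (N X) \<le> \<eta> * X" using X \<open>0 < \<eta>\<close> by (simp add: N_def)
            have "\<bar>?F n / (X * f X)\<bar> \<le> (\<eta>\<^sup>2 + 1) / X" if n: "n \<in> {m..<N X}" for n
            proof -
              define y where "y = real n / X"
              have n0: "real n > 0" "real n \<ge> T2" "f n > 0" using n m m1 by (auto intro!: f_pos)
              have y: "y > 0" using n0 X by (simp add: y_def)
              have "real n \<le> \<eta> * X" using NX n by simp
              then have y\<eta>: "y \<le> \<eta>" using X by (simp add: y_def field_simps)
              have "\<bar>?F n / (X * f X)\<bar> = f n / f X * \<bar>sin y\<bar> / X"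
                using n0 X by (simp add: abs_mult y_def)
              also have "\<dots> \<le> (y + 1 / y) * y / X"
              proof -
                have "f n / f X \<le> y + 1 / y"
                  using le[of "real n" X] n0 X y \<theta> by (simp add: y_def powr_minus_divide)
                moreover have "\<bar>sin y\<bar> \<le> y" using abs_sin_x_le_abs_x[of y] y by simp
                ultimately show ?thesis using X y by (intro divide_right_mono mult_mono) auto
              qed
              also have "\<dots> = (y\<^sup>2 + 1) / X" using y by (simp add: distrib_right power2_eq_square)
              also have "\<dots> \<le> (\<eta>\<^sup>2 + 1) / X"
                using y y\<eta> X by (intro divide_right_mono add_right_mono power_mono) auto
              finally show ?thesis .
            qed
            then have "(\<Sum>n=m..<N X. \<bar>?F n / (X * f X)\<bar>) \<le> (\<Sum>n=m..<N X. (\<eta>\<^sup>2 + 1) / X)"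
              by (intro sum_mono)
            also have "\<dots> \<le> real (N X) * ((\<eta>\<^sup>2 + 1) / X)"
              using X by (simp add: divide_right_mono mult_right_mono)
            also have "\<dots> \<le> (\<eta> * X) * ((\<eta>\<^sup>2 + 1) / X)"
              using NX X by (intro mult_right_mono) auto
            also have "\<dots> = \<eta> * (\<eta>\<^sup>2 + 1)" using X by simp
            finally show ?thesis unfolding sum_divide_distrib by (rule order_trans[OF sum_abs])
          qed
          have sT: "summable (\<lambda>k. ?F (k + N X))" using sF by (rule summable_ignore_initial_segment)
          have f0: "(\<lambda>k. f (real (k + N X))) \<longlonglongrightarrow> 0"
            by (rule LIMSEQ_ignore_initial_segment[OF filterlim_compose[OF lim filterlim_real_sequentially]])
          \<comment> \<open>The slope at \<open>real (k + N X) + 1\<close> lies between two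
            consecutive differences.\<close>
          have \<Delta>_dec: "decseq ?\<Delta>"
          proof (rule decseq_SucI)
            fix k
            have a: "real (k + N X) \<ge> real m" "real (Suc k + N X) \<ge> real m" using mN by auto
            have "?\<Delta> (Suc k) \<le> - f (real (k + N X) + 1) * h (ln (real (k + N X) + 1)) / (real (k + N X) + 1)"
              using diff_between_slopes(1)[OF m(4) mono a(2)] by (simp add: algebra_simps)
            also have "\<dots> \<le> ?\<Delta> k"
              using diff_between_slopes(2)[OF m(4) mono a(1)] by (simp add: algebra_simps)
            finally show "?\<Delta> (Suc k) \<le> ?\<Delta> k" .
          qed
          have "?\<Delta> \<longlonglongrightarrow> 0 - 0"
            using f0 LIMSEQ_Suc[OF f0] by (intro tendsto_diff)
          then have \<Delta>_lim: "?\<Delta> \<longlonglongrightarrow> 0" by simp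
          \<comment> \<open>A cosine is a sine shifted by \<open>pi / 2\<close>, so Dirichlet's test
            for sines applies.\<close>
          have c_eq: "?c (Suc k) = sin ((real (N X) / X + 1 / X / 2 + pi / 2) + real k * (1 / X))" for k
          proof -
            have "(real (N X) / X + 1 / X / 2 + pi / 2) + real k * (1 / X) = (real (Suc k + N X) / X - 1 / X / 2) + pi / 2"
              using X by (simp add: field_simps)
            then show ?thesis by (simp only: sin_add) simp
          qed
          have sc: "summable (\<lambda>k. ?\<Delta> k * ?c (Suc k))"
            and bc: "\<bar>\<Sum>k. ?\<Delta> k * ?c (Suc k)\<bar> \<le> ?\<Delta> 0 / ?s"
            using summable_decseq_mult_sin[OF \<Delta>_dec \<Delta>_lim, of "1 / X"]
              abs_suminf_decseq_mult_sin_le[OF \<Delta>_dec \<Delta>_lim, of "1 / X"] s(1)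
            unfolding c_eq by auto
          \<comment> \<open>One summation by parts turns the tail into a cosine series with coefficients \<open>?\<Delta>\<close>,
            which decrease by convexity.\<close>
          have parts: "2 * ?s * ?F (k + N X) = - (?\<Delta> k * ?c (Suc k))
              - (f (real (Suc k + N X)) * ?c (Suc k) - f (real (k + N X)) * ?c k)" for k
          proof -
            let ?z = "real (k + N X) / X"
            have "?c (Suc k) = cos (?z + 1 / X / 2)"
              using X by (intro arg_cong[where f = cos]) (simp add: field_simps)
            then have "?c k - ?c (Suc k) = 2 * ?s * sin ?z"
              by (simp add: cos_diff cos_add)
            then have "f (real (k + N X)) * (2 * ?s * sin ?z) = f (real (k + N X)) * (?c k - ?c (Suc k))"
              by simp
            then show ?thesis by (simp only: algebra_simps)
          qed
          \<comment> \<open>The boundary term at infinity vanishes because \<open>f\<close> tends to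
            0; the one at \<open>k = 0\<close> is the main term.\<close>
          have "(\<lambda>k. f (real (Suc k + N X)) * ?c (Suc k) - f (real (k + N X)) * ?c k) sums
              (0 - f (real (0 + N X)) * ?c 0)"
          proof (rule telescope_sums[of "\<lambda>k. f (real (k + N X)) * ?c k"])
            show "(\<lambda>k. f (real (k + N X)) * ?c k) \<longlonglongrightarrow> 0"
            proof (rule Lim_null_comparison[OF always_eventually tendsto_rabs_zero[OF f0]], rule allI)
              show "norm (f (real (k + N X)) * ?c k) \<le> \<bar>f (real (k + N X))\<bar>" for k
                using mult_left_mono[OF abs_cos_le_one abs_ge_zero] by (simp add: abs_mult)
            qed
          qed
          from sums_diff[OF sums_minus[OF summable_sums[OF sc]] this]
          have "(\<lambda>k. 2 * ?s * ?F (k + N X)) sums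
              (- (\<Sum>k. ?\<Delta> k * ?c (Suc k)) - (0 - f (real (0 + N X)) * ?c 0))"
            unfolding parts .
          moreover have "(\<lambda>k. 2 * ?s * ?F (k + N X)) sums (2 * ?s * ?tail)"
            by (intro sums_mult summable_sums sT)
          ultimately have tail: "2 * ?s * ?tail = f (real (N X)) * cos (real (N X) / X - 1 / X / 2) - (\<Sum>k. ?\<Delta> k * ?c (Suc k))"
            using sums_unique2 by fastforce
          let ?R = "\<Sum>k. ?\<Delta> k * ?c (Suc k)"
          have "?tail = (f (real (N X)) * cos (real (N X) / X - 1 / X / 2) - ?R) / (2 * ?s)"
            using tail s(1) by (simp add: field_simps)
          then have tailH: "?tail / (X * f X) = H X - ?R / (2 * ?s) / (X * f X)"
            using s(1) X by (simp add: H_def field_simps)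
          have Rb: "\<bar>?R / (2 * ?s) / (X * f X)\<bar> \<le> 8 * (f (real (N X)) / f X * - h (ln (real (N X))) / (real (N X) / X))"
          proof -
            \<comment> \<open>\<open>q\<close> is \<open>- f'\<close> at \<open>real (N X)\<close>.
              The factor \<open>1 / ?s\<close> enters twice, through Dirichlet's test and through
              the division by \<open>2 * ?s\<close>; as each is at most \<open>4 * X\<close>, the
              constant is \<open>16 / 2 = 8\<close>.\<close>
            define q where "q = - f (real (N X)) * h (ln (real (N X))) / real (N X)"
            have "?\<Delta> 0 \<le> q"
              using diff_between_slopes(1)[OF m(4) mono, of "real (N X)"] mN by (simp add: q_def add.commute)
            moreover have \<Delta>0: "?\<Delta> 0 \<ge> 0" using decseq_ge[OF \<Delta>_dec \<Delta>_lim] .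
            ultimately have "\<bar>?R\<bar> \<le> q / ?s"
              using bc s(1) by (meson divide_right_mono less_imp_le order_trans)
            then have "\<bar>?R\<bar> / (2 * ?s) / (X * f X) \<le> q / ?s / (2 * ?s) / (X * f X)"
              using s(1) X by (intro divide_right_mono) auto
            then have "\<bar>?R / (2 * ?s) / (X * f X)\<bar> \<le> q / ?s / (2 * ?s) / (X * f X)"
              using s(1) X by (simp add: abs_mult)
            also have "\<dots> = q * (1 / ?s)\<^sup>2 / (2 * X * f X)" by (simp add: power2_eq_square)
            also have "\<dots> \<le> q * (4 * X)\<^sup>2 / (2 * X * f X)"
              using s X \<open>?\<Delta> 0 \<le> q\<close> \<Delta>0 by (intro divide_right_mono mult_left_mono power_mono) auto
            also have "\<dots> = 8 * (f (real (N X)) / f X * - h (ln (real (N X))) / (real (N X) / X))"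
              using X by (simp add: q_def power2_eq_square)
            finally show ?thesis .
          qed
          have "suminf ?F / (X * f X) - H X = (\<Sum>n<m. ?F n) / (X * f X) +
              (\<Sum>n=m..<N X. ?F n) / (X * f X) - ?R / (2 * ?s) / (X * f X)"
            unfolding split add_divide_distrib tailH by simp
          then show ?case using head Rb unfolding r_def by linarith
        qed
      qed
      ultimately show ?case by blast
    qed
  qed simp
qed

text \<open>In the coordinate \<open>u = ln t\<close> the slope \<open>- f' t\<close> is
  \<open>- exp (\<phi> u - u) * h u\<close>, and \<open>(h u)\<^sup>2 - h u + h' u\<close> equals
  \<open>t\<^sup>2 * f'' t / f t\<close>. The assumption \<open>nonneg\<close> is thus eventual
  convexity of \<open>f\<close> in logarithmic coordinates.\<close>

lemma antimono_slope:
  assumes h': "\<And>u. u \<ge> U \<Longrightarrow> (h has_real_derivative h' u) (at u)"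
    and nonneg: "\<forall>\<^sub>F u in at_top. (h u)\<^sup>2 - h u + h' u \<ge> 0"
  obtains T where "antimono_on {T..} (\<lambda>t. - f t * h (ln t) / t)"
proof -
  from nonneg obtain V0 where V0: "\<And>u. u \<ge> V0 \<Longrightarrow> (h u)\<^sup>2 - h u + h' u \<ge> 0"
    by (auto simp: eventually_at_top_linorder)
  define V where "V = max U V0"
  show thesis
  proof (rule that, intro monotone_onI)
    fix s t assume st: "s \<in> {exp V..}" "t \<in> {exp V..}" "s \<le> t"
    have pos: "s > 0" "t > 0" using st exp_gt_zero[of V] unfolding atLeast_iff by linarith+
    have lns: "ln s \<ge> V" using st pos by (simp add: ln_ge_iff)
    let ?g = "\<lambda>u. - exp (\<phi> u - u) * h u"
    have "?g (ln t) \<le> ?g (ln s)"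
    proof (rule DERIV_nonpos_imp_nonincreasing[of "ln s" "ln t" ?g])
      show "ln s \<le> ln t" using st pos by simp
      fix u assume "ln s \<le> u" "u \<le> ln t"
      with lns have u: "u \<ge> U" "u \<ge> V0" by (auto simp: V_def)
      have "(?g has_real_derivative - exp (\<phi> u - u) * ((h u)\<^sup>2 - h u + h' u)) (at u)"
        using deriv[OF u(1)] h'[OF u(1)]
        by (auto intro!: derivative_eq_intros simp: algebra_simps power2_eq_square)
      moreover have "- exp (\<phi> u - u) * ((h u)\<^sup>2 - h u + h' u) \<le> 0"
        using V0[OF u(2)] by simp
      ultimately show "\<exists>y. (?g has_real_derivative y) (at u) \<and> y \<le> 0" by blast
    qed
    moreover have "?g (ln z) = - f z * h (ln z) / z" if "z \<in> {exp V..}" "z > 0" for z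
    proof -
      have "exp U \<le> exp V" by (simp add: V_def)
      then have "f z = exp (\<phi> (ln z))" using that unfolding atLeast_iff by (intro f_eq) linarith
      then show ?thesis using that by (simp add: exp_diff)
    qed
    ultimately show "- f t * h (ln t) / t \<le> - f s * h (ln s) / s"
      using st pos by simp
  qed
qed

end

section \<open>The Mathieu coefficients\<close>

text \<open>In \<open>u = ln n\<close>, the quantity \<open>w u\<close> below is the ratio of \<open>r\<^sup>2\<close> to \<open>n powr \<beta> * ln n powr \<delta>\<close>.\<close>

locale mathieu =
  fixes \<mu> r \<alpha> \<beta> \<gamma> \<delta> :: real
  assumes \<mu>: "\<mu> \<ge> 0"
    and dominant: "r = 0 \<or> \<beta> > 0 \<or> (\<beta> = 0 \<and> \<delta> > 0)"
begin

definition "\<theta> = \<beta> * (\<mu> + 1) - \<alpha>"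
definition "\<kappa> = \<gamma> - \<delta> * (\<mu> + 1)"
definition "f t = t powr \<alpha> * ln t powr \<gamma> / (t powr \<beta> * ln t powr \<delta> + r\<^sup>2) powr (\<mu> + 1)"
definition "w u = r\<^sup>2 * (exp (- \<beta> * u) * u powr (- \<delta>))"
definition "\<phi> u = - \<theta> * u + \<kappa> * ln u - (\<mu> + 1) * ln (1 + w u)"
text \<open>For positive \<open>u\<close> the derivative of \<open>w\<close> is
  \<open>- w u * p u\<close>; \<open>h\<close> and \<open>h'\<close> are the first and second
  derivatives of \<phi>.\<close>

definition "p u = \<beta> + \<delta> / u"
definition "h u = - \<theta> + \<kappa> / u + (\<mu> + 1) * (w u * p u / (1 + w u))"
definition "h' u = - \<kappa> / u\<^sup>2 - (\<mu> + 1) * (\<delta> / u\<^sup>2 * (w u / (1 + w u)) + (p u)\<^sup>2 * w u / (1 + w u)\<^sup>2)"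

section \<open>Limits and derivatives of the logarithmic quantities\<close>

lemma w_nonneg: "w u \<ge> 0"
  by (simp add: w_def)

text \<open>Here the hypothesis \<open>dominant\<close> enters. The second limit keeps the factor
  \<beta>: for \<open>\<beta> = 0\<close> the product \<open>u * w u\<close> is
  \<open>r\<^sup>2 * u powr (1 - \<delta>)\<close> and need not tend to 0, but it occurs only
  multiplied by \<beta>.\<close>

lemma w_tendsto: "(w \<longlongrightarrow> 0) at_top" "((\<lambda>u. \<beta> * u * w u) \<longlongrightarrow> 0) at_top"
proof -
  consider "r = 0" | "\<beta> > 0" | "\<beta> = 0" "\<delta> > 0" using dominant by blast
  then have "(w \<longlongrightarrow> 0) at_top \<and> ((\<lambda>u. \<beta> * u * w u) \<longlongrightarrow> 0) at_top"
  proof cases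
    case 1
    then have "w u = 0" for u unfolding w_def by simp
    then have "w = (\<lambda>_. 0)" by (rule ext)
    then show ?thesis by simp
  next
    case 2
    have "((\<lambda>u. exp (- \<beta> * u) * u powr (- \<delta>)) \<longlongrightarrow> 0) at_top"
      "((\<lambda>u. u * (exp (- \<beta> * u) * u powr (- \<delta>))) \<longlongrightarrow> 0) at_top"
      using 2 by real_asymp+
    then have "((\<lambda>u. r\<^sup>2 * (exp (- \<beta> * u) * u powr (- \<delta>))) \<longlongrightarrow> r\<^sup>2 * 0) at_top"
      "((\<lambda>u. \<beta> * r\<^sup>2 * (u * (exp (- \<beta> * u) * u powr (- \<delta>)))) \<longlongrightarrow> \<beta> * r\<^sup>2 * 0) at_top"
      by (intro tendsto_mult tendsto_const; simp)+
    then show ?thesis by (simp add: w_def[abs_def] mult_ac)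
  next
    case 3
    then have "((\<lambda>u. u powr (- \<delta>)) \<longlongrightarrow> 0) at_top"
      by (intro tendsto_neg_powr filterlim_ident) auto
    then have "((\<lambda>u. r\<^sup>2 * u powr (- \<delta>)) \<longlongrightarrow> r\<^sup>2 * 0) at_top"
      by (intro tendsto_mult tendsto_const)
    then show ?thesis unfolding w_def[abs_def] using 3(1) by simp
  qed
  then show "(w \<longlongrightarrow> 0) at_top" "((\<lambda>u. \<beta> * u * w u) \<longlongrightarrow> 0) at_top" by auto
qed

lemma inverse_tendsto: "((\<lambda>u::real. 1 / u) \<longlongrightarrow> 0) at_top"
  by real_asymp

text \<open>The next term in the expansion of \<open>h\<close>. For \<open>\<theta> = 0\<close> the
  limit of \<open>h\<close> is 0, and both the sign of \<open>h\<close> and the convexity of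
  \<open>f\<close> are decided by \<open>\<kappa> / u\<close>.\<close>

lemma u_h_tendsto: "((\<lambda>u. u * (h u + \<theta>)) \<longlongrightarrow> \<kappa>) at_top"
proof -
  have "((\<lambda>u. \<kappa> + (\<mu> + 1) * ((\<beta> * u * w u + \<delta> * w u) / (1 + w u))) \<longlongrightarrow>
      \<kappa> + (\<mu> + 1) * ((0 + \<delta> * 0) / (1 + 0))) at_top"
    by (intro tendsto_intros w_tendsto) auto
  moreover have "\<forall>\<^sub>F u in at_top. \<kappa> + (\<mu> + 1) * ((\<beta> * u * w u + \<delta> * w u) / (1 + w u)) = u * (h u + \<theta>)"
    using eventually_gt_at_top[of 0]
  proof eventually_elim
    case (elim u)
    have "\<beta> * u * w u + \<delta> * w u = u * (w u * p u)" using elim by (simp add: p_def field_simps)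
    moreover have "u * (h u + \<theta>) = \<kappa> + (\<mu> + 1) * (u * (w u * p u) / (1 + w u))"
      using elim by (simp add: h_def algebra_simps)
    ultimately show ?case by simp
  qed
  ultimately show ?thesis by (simp add: tendsto_cong)
qed

lemma h_tendsto: "(h \<longlongrightarrow> - \<theta>) at_top"
proof -
  have "((\<lambda>u. u * (h u + \<theta>) * (1 / u) - \<theta>) \<longlongrightarrow> \<kappa> * 0 - \<theta>) at_top"
    by (intro tendsto_diff tendsto_mult u_h_tendsto inverse_tendsto tendsto_const)
  moreover have "\<forall>\<^sub>F u in at_top. u * (h u + \<theta>) * (1 / u) - \<theta> = h u"
    using eventually_gt_at_top[of 0] by eventually_elim simp
  ultimately show ?thesis by (simp add: tendsto_cong)
qed

text \<open>For \<open>\<theta> = 0\<close> this makes \<open>h' u\<close> negligible in the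
  convexity condition against \<open>- h u\<close>, which is about
  \<open>- \<kappa> / u\<close>.\<close>

lemma u_h'_tendsto: "((\<lambda>u. u * h' u) \<longlongrightarrow> 0) at_top"
proof -
  let ?g = "\<lambda>u. - \<kappa> * (1 / u) - (\<mu> + 1) * (\<delta> * (1 / u) * (w u / (1 + w u)) +
      (\<beta> * (\<beta> * u * w u) + 2 * \<beta> * \<delta> * w u + \<delta>\<^sup>2 * (1 / u) * w u) / (1 + w u)\<^sup>2)"
  have "(?g \<longlongrightarrow> - \<kappa> * 0 - (\<mu> + 1) * (\<delta> * 0 * (0 / (1 + 0)) +
      (\<beta> * 0 + 2 * \<beta> * \<delta> * 0 + \<delta>\<^sup>2 * 0 * 0) / (1 + 0)\<^sup>2)) at_top"
    by (intro tendsto_intros w_tendsto inverse_tendsto) auto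
  moreover have "\<forall>\<^sub>F u in at_top. ?g u = u * h' u"
    using eventually_gt_at_top[of 0]
  proof eventually_elim
    case (elim u)
    have "\<beta> * (\<beta> * u * w u) + 2 * \<beta> * \<delta> * w u + \<delta>\<^sup>2 * (1 / u) * w u = u * ((p u)\<^sup>2 * w u)"
      using elim by (simp add: p_def power2_sum power_divide field_simps power2_eq_square)
    moreover have "u * h' u = - \<kappa> * (u / u\<^sup>2) - (\<mu> + 1) * (\<delta> * (u / u\<^sup>2) * (w u / (1 + w u)) +
        u * ((p u)\<^sup>2 * w u) / (1 + w u)\<^sup>2)"
      by (simp add: h'_def algebra_simps)
    moreover have "u / u\<^sup>2 = 1 / u" using elim by (simp add: power2_eq_square)
    ultimately show ?case by simp
  qed
  ultimately show ?thesis by (simp add: tendsto_cong)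
qed

lemma DERIV_w:
  assumes "u > 0"
  shows "(w has_real_derivative - w u * p u) (at u)"
proof -
  have "((\<lambda>u. u powr (- \<delta>)) has_real_derivative - \<delta> / u * u powr (- \<delta>)) (at u)"
    using has_real_derivative_powr[OF assms, of "- \<delta>"] assms by (simp add: powr_diff)
  moreover have "((\<lambda>u. exp (- \<beta> * u)) has_real_derivative - \<beta> * exp (- \<beta> * u)) (at u)"
    by (auto intro!: derivative_eq_intros)
  ultimately have "((\<lambda>u. r\<^sup>2 * (exp (- \<beta> * u) * u powr (- \<delta>))) has_real_derivative
      r\<^sup>2 * (- \<beta> * exp (- \<beta> * u) * u powr (- \<delta>) + - \<delta> / u * u powr (- \<delta>) * exp (- \<beta> * u))) (at u)"
    by (intro DERIV_cmult DERIV_mult)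
  also have "r\<^sup>2 * (- \<beta> * exp (- \<beta> * u) * u powr (- \<delta>) + - \<delta> / u * u powr (- \<delta>) * exp (- \<beta> * u)) =
      - w u * p u"
    by (simp add: w_def p_def algebra_simps)
  finally show ?thesis by (simp add: w_def[abs_def])
qed

lemma DERIV_\<phi>:
  assumes "u > 0"
  shows "(\<phi> has_real_derivative h u) (at u)"
proof -
  have "1 + w u > 0" using w_nonneg[of u] by simp
  then have "((\<lambda>u. ln (1 + w u)) has_real_derivative 1 / (1 + w u) * (0 + - w u * p u)) (at u)"
    by (intro DERIV_chain2[OF DERIV_ln_divide] DERIV_add DERIV_const DERIV_w assms)
  then have "((\<lambda>u. - \<theta> * u + \<kappa> * ln u - (\<mu> + 1) * ln (1 + w u)) has_real_derivative
      - \<theta> + \<kappa> * (1 / u) - (\<mu> + 1) * (1 / (1 + w u) * (0 + - w u * p u))) (at u)"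
    using assms by (intro DERIV_diff DERIV_add DERIV_cmult DERIV_cmult_Id DERIV_ln_divide)
  then show ?thesis by (simp add: \<phi>_def[abs_def] h_def)
qed

lemma DERIV_h:
  assumes "u > 0"
  shows "(h has_real_derivative h' u) (at u)"
proof -
  have w: "1 + w u > 0" using w_nonneg[of u] by simp
  have p: "(p has_real_derivative - \<delta> / u\<^sup>2) (at u)"
    unfolding p_def[abs_def] using assms
    by (auto intro!: derivative_eq_intros simp: power2_eq_square)
  have k: "((\<lambda>u. \<kappa> / u) has_real_derivative - \<kappa> / u\<^sup>2) (at u)"
    using assms by (auto intro!: derivative_eq_intros simp: power2_eq_square)
  have "((\<lambda>u. w u * p u / (1 + w u)) has_real_derivative
      ((- w u * p u * p u + w u * (- \<delta> / u\<^sup>2)) * (1 + w u) - w u * p u * (- w u * p u)) / (1 + w u)\<^sup>2) (at u)"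
    using w by (auto intro!: derivative_eq_intros p DERIV_w[OF assms] simp: power2_eq_square)
  also have "((- w u * p u * p u + w u * (- \<delta> / u\<^sup>2)) * (1 + w u) - w u * p u * (- w u * p u)) / (1 + w u)\<^sup>2 =
      - (\<delta> / u\<^sup>2 * (w u / (1 + w u)) + (p u)\<^sup>2 * w u / (1 + w u)\<^sup>2)"
  proof -
    have "((- W * P * P + W * (- D)) * (1 + W) - W * P * (- W * P)) / (1 + W)\<^sup>2 =
        - (D * (W / (1 + W)) + P\<^sup>2 * W / (1 + W)\<^sup>2)" if "1 + W > 0" for W P D :: real
    proof -
      have "D * (W / (1 + W)) = D * W * (1 + W) / (1 + W)\<^sup>2"
        using that by (simp add: power2_eq_square)
      then show ?thesis
        by (simp only: add_divide_distrib[symmetric] minus_divide_left) (simp add: algebra_simps power2_eq_square)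
    qed
    from this[OF w, of "p u" "\<delta> / u\<^sup>2"] show ?thesis by simp
  qed
  finally have "((\<lambda>u. - \<theta> + \<kappa> / u + (\<mu> + 1) * (w u * p u / (1 + w u))) has_real_derivative
      0 + - \<kappa> / u\<^sup>2 + (\<mu> + 1) * - (\<delta> / u\<^sup>2 * (w u / (1 + w u)) + (p u)\<^sup>2 * w u / (1 + w u)\<^sup>2)) (at u)"
    using k by (intro DERIV_add DERIV_const DERIV_cmult)
  also have "0 + - \<kappa> / u\<^sup>2 + (\<mu> + 1) * - (\<delta> / u\<^sup>2 * (w u / (1 + w u)) + (p u)\<^sup>2 * w u / (1 + w u)\<^sup>2) = h' u"
    unfolding h'_def by (simp only: mult_minus_right)
  finally show ?thesis by (simp add: h_def[abs_def])
qed

text \<open>With \<open>B = t powr \<beta> * ln t powr \<delta>\<close> the base in the denominator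
  is \<open>B * (1 + w (ln t))\<close>; \<open>t > 1\<close> makes \<open>ln t\<close>, and with it
  \<open>B\<close>, positive.\<close>

lemma f_eq_w:
  assumes "t > 1"
  shows "f t = t powr (- \<theta>) * ln t powr \<kappa> * (1 + w (ln t)) powr (- (\<mu> + 1))"
proof -
  define B where "B = t powr \<beta> * ln t powr \<delta>"
  have l: "ln t > 0" using assms by simp
  have B: "B > 0" using assms l by (simp add: B_def)
  have wB: "w (ln t) = r\<^sup>2 / B"
    using assms by (simp add: w_def B_def powr_def exp_minus field_simps)
  have "B + r\<^sup>2 = B * (1 + w (ln t))" using B by (simp add: wB field_simps)
  then have "f t = t powr \<alpha> * ln t powr \<gamma> / (B powr (\<mu> + 1) * (1 + w (ln t)) powr (\<mu> + 1))"
    using B w_nonneg[of "ln t"] by (simp add: f_def B_def[symmetric] powr_mult)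
  also have "B powr (\<mu> + 1) = t powr (\<beta> * (\<mu> + 1)) * ln t powr (\<delta> * (\<mu> + 1))"
    by (simp add: B_def powr_mult powr_powr)
  also have "t powr \<alpha> * ln t powr \<gamma> / (t powr (\<beta> * (\<mu> + 1)) * ln t powr (\<delta> * (\<mu> + 1)) * (1 + w (ln t)) powr (\<mu> + 1)) =
      (t powr \<alpha> / t powr (\<beta> * (\<mu> + 1))) * (ln t powr \<gamma> / ln t powr (\<delta> * (\<mu> + 1))) * (1 / (1 + w (ln t)) powr (\<mu> + 1))"
    by simp
  also have "\<dots> = t powr (- \<theta>) * ln t powr \<kappa> * (1 + w (ln t)) powr (- (\<mu> + 1))"
    by (simp only: powr_diff[symmetric] powr_minus_divide[symmetric]) (simp add: \<theta>_def \<kappa>_def)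
  finally show ?thesis .
qed

text \<open>The threshold \<open>U = 1\<close> keeps \<open>u\<close> positive, where
  \<open>ln u\<close> and \<open>u powr (- \<delta>)\<close> are differentiable.\<close>

sublocale regularly_varying f \<phi> h \<theta> 1
proof
  fix t :: real assume t: "t \<ge> exp 1"
  have t1: "t > 1" using t exp_gt_one[of "1::real"] by linarith
  have "1 + w (ln t) > 0" using w_nonneg[of "ln t"] by simp
  then have "(1 + w (ln t)) powr (- (\<mu> + 1)) = 1 / exp ((\<mu> + 1) * ln (1 + w (ln t)))"
    unfolding powr_minus_divide by (simp add: powr_def)
  then show "f t = exp (\<phi> (ln t))"
    unfolding f_eq_w[OF t1] \<phi>_def exp_add exp_diff using t1 by (simp add: powr_def)
qed (use DERIV_\<phi> h_tendsto in auto)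

text \<open>The parameter \<open>r\<close> disappears from the asymptotics here, because
  \<open>w\<close> tends to 0.\<close>

lemma f_ratio_tendsto: "((\<lambda>X. f X / (X powr (- \<theta>) * ln X powr \<kappa>)) \<longlongrightarrow> 1) at_top"
proof -
  have "((\<lambda>X. (1 + w (ln X)) powr (- (\<mu> + 1))) \<longlongrightarrow> (1 + 0) powr (- (\<mu> + 1))) at_top"
    by (intro tendsto_powr tendsto_add tendsto_const filterlim_compose[OF w_tendsto(1) ln_at_top]) auto
  moreover have "\<forall>\<^sub>F X in at_top. (1 + w (ln X)) powr (- (\<mu> + 1)) = f X / (X powr (- \<theta>) * ln X powr \<kappa>)"
    using eventually_gt_at_top[of 1] by eventually_elim (simp add: f_eq_w)
  ultimately show ?thesis by (simp add: tendsto_cong)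
qed

text \<open>For \<open>\<theta> = 0\<close> the convergence of \<open>h\<close> to 0 settles no
  sign; the sign is read off from the negative limit \<kappa> of \<open>u * h u\<close>, and the
  decay of \<open>f\<close> comes from the logarithmic factor alone.\<close>

lemma
  assumes \<theta>: "0 \<le> \<theta>" and \<kappa>: "\<theta> = 0 \<Longrightarrow> \<kappa> < 0"
  shows eventually_h_nonpos: "\<forall>\<^sub>F u in at_top. h u \<le> 0"
    and f_tendsto_0: "(f \<longlongrightarrow> 0) at_top"
proof -
  show "\<forall>\<^sub>F u in at_top. h u \<le> 0"
  proof (cases "\<theta> = 0")
    case True
    have "\<forall>\<^sub>F u in at_top. u * (h u + \<theta>) < 0"
      using u_h_tendsto \<kappa>[OF True] by (rule order_tendstoD(2))
    then show ?thesis using eventually_gt_at_top[of 0]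
      by eventually_elim (use True in \<open>auto simp: mult_less_0_iff\<close>)
  next
    case False
    then have "\<forall>\<^sub>F u in at_top. h u < 0"
      using h_tendsto \<theta> by (intro order_tendstoD(2)) auto
    then show ?thesis by eventually_elim simp
  qed
  show "(f \<longlongrightarrow> 0) at_top"
  proof (cases "\<theta> = 0")
    case True
    have "((\<lambda>X. ln X powr \<kappa>) \<longlongrightarrow> 0) at_top"
      using \<kappa>[OF True] by (intro tendsto_neg_powr ln_at_top)
    then have "((\<lambda>X. f X / (X powr (- \<theta>) * ln X powr \<kappa>) * ln X powr \<kappa>) \<longlongrightarrow> 1 * 0) at_top"
      by (intro tendsto_mult f_ratio_tendsto)
    moreover have "\<forall>\<^sub>F X in at_top. f X / (X powr (- \<theta>) * ln X powr \<kappa>) * ln X powr \<kappa> = f X"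
      using eventually_gt_at_top[of 1] by eventually_elim (use True in simp)
    ultimately show ?thesis by (simp add: tendsto_cong)
  qed (use \<theta> tendsto_0 in auto)
qed

text \<open>At \<open>\<theta> = 0\<close> the quotient has denominator 0 and hence the value 0 in
  HOL; the value 1 is its limit as \<theta> decreases to 0.\<close>

definition "leading = (if \<theta> = 0 then 1 else pi / (2 * Gamma \<theta> * sin (pi * \<theta> / 2)))"

lemma sine_series_limit:
  assumes \<theta>: "0 \<le> \<theta>" "\<theta> < 2" and \<kappa>: "\<theta> = 0 \<Longrightarrow> \<kappa> < 0"
  shows "((\<lambda>X. (\<Sum>n. f (real n) * sin (real n / X)) / (X * f X)) \<longlongrightarrow> leading) at_top"
proof (cases "\<theta> = 0")
  case True
  \<comment> \<open>For \<open>\<theta> = 0\<close> this is \<open>u\<close> times the convexity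
    expression; its limit \<open>- \<kappa>\<close> is positive, so \<open>f\<close> is eventually
    convex.\<close>
  have "((\<lambda>u. u * (h u + \<theta>) * h u - u * (h u + \<theta>) + u * h' u) \<longlongrightarrow> \<kappa> * - \<theta> - \<kappa> + 0) at_top"
    by (intro tendsto_add tendsto_diff tendsto_mult u_h_tendsto u_h'_tendsto h_tendsto)
  then have "\<forall>\<^sub>F u in at_top. u * (h u + \<theta>) * h u - u * (h u + \<theta>) + u * h' u > 0"
    using True \<kappa>[OF True] by (intro order_tendstoD(1)) auto
  then have "\<forall>\<^sub>F u in at_top. (h u)\<^sup>2 - h u + h' u \<ge> 0"
    using eventually_gt_at_top[of 0]
  proof eventually_elim
    case (elim u)
    have "u * (h u + \<theta>) * h u - u * (h u + \<theta>) + u * h' u = u * ((h u)\<^sup>2 - h u + h' u)"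
      using True by (simp add: algebra_simps power2_eq_square)
    then show ?case using elim by (simp add: zero_less_mult_iff)
  qed
  from antimono_slope[OF DERIV_h this]
  obtain T where "antimono_on {T..} (\<lambda>t. - f t * h (ln t) / t)" by auto
  from sine_series_limit_0[OF True eventually_h_nonpos[OF \<theta>(1) \<kappa>] f_tendsto_0[OF \<theta>(1) \<kappa>] this]
  show ?thesis using True by (simp add: leading_def)
next
  case False
  then show ?thesis using sine_series_limit_pos \<theta> by (simp add: leading_def)
qed

section \<open>From \<open>f\<close> back to the Mathieu sine series\<close>

lemma mathieu_sin_term_eq: "mathieu_sin_term \<mu> r \<alpha> \<beta> \<gamma> \<delta> x = (\<lambda>n. f (real (n + 2)) * sin (real (n + 2) * x))"
  by (simp add: fun_eq_iff mathieu_sin_term_def mathieu_coeff_def f_def)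

lemma leading_pos:
  assumes "0 \<le> \<theta>" "\<theta> < 2"
  shows "leading > 0"
proof (cases "\<theta> = 0")
  case False
  then have "sin (pi * \<theta> / 2) > 0" "Gamma \<theta> > 0"
    using assms by (auto intro!: sin_gt_zero Gamma_real_pos simp: field_simps)
  then show ?thesis using False by (simp add: leading_def)
qed (simp add: leading_def)

lemma summable_mathieu_sin_term:
  assumes "0 \<le> \<theta>" "\<theta> = 0 \<Longrightarrow> \<kappa> < 0" "0 < x" "x \<le> 1"
  shows "summable (mathieu_sin_term \<mu> r \<alpha> \<beta> \<gamma> \<delta> x)"
    and "mathieu_sin_series \<mu> r \<alpha> \<beta> \<gamma> \<delta> x =
      (\<Sum>n. f (real n) * sin (real n * x)) - (\<Sum>n<2. f (real n) * sin (real n * x))"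
proof -
  have "1 / x \<ge> 1" using assms by simp
  with summable_sine[OF eventually_h_nonpos f_tendsto_0] assms
  have "summable (\<lambda>n. f (real n) * sin (real n / (1 / x)))" by blast
  then have sm: "summable (\<lambda>n. f (real n) * sin (real n * x))" by simp
  show "summable (mathieu_sin_term \<mu> r \<alpha> \<beta> \<gamma> \<delta> x)"
    unfolding mathieu_sin_term_eq by (rule summable_ignore_initial_segment[OF sm])
  show "mathieu_sin_series \<mu> r \<alpha> \<beta> \<gamma> \<delta> x =
      (\<Sum>n. f (real n) * sin (real n * x)) - (\<Sum>n<2. f (real n) * sin (real n * x))"
    unfolding mathieu_sin_series_def mathieu_sin_term_eq by (rule suminf_minus_initial_segment[OF sm])
qed

text \<open>Multiplication by the ratio in \<open>f_ratio_tendsto\<close> replaces the normalisation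
  \<open>X * f X\<close> by explicit powers; the two surplus initial terms are negligible.\<close>

lemma mathieu_sin_series_limit:
  assumes \<theta>: "0 \<le> \<theta>" "\<theta> < 2" and \<kappa>: "\<theta> = 0 \<Longrightarrow> \<kappa> < 0"
  shows "((\<lambda>X. mathieu_sin_series \<mu> r \<alpha> \<beta> \<gamma> \<delta> (inverse X) / (leading * (X powr (1 - \<theta>) * ln X powr \<kappa>)))
    \<longlongrightarrow> 1) at_top"
proof -
  have "((\<lambda>X. ((\<Sum>n. f (real n) * sin (real n / X)) / (X * f X) - (\<Sum>n<2. f (real n) * sin (real n / X)) / (X * f X))
      * (f X / (X powr (- \<theta>) * ln X powr \<kappa>)) / leading) \<longlongrightarrow> (leading - 0) * 1 / leading) at_top"
    using \<theta> leading_pos[OF \<theta>]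
    by (intro tendsto_intros sine_series_limit f_ratio_tendsto finite_sine_sum_negligible) (use \<kappa> in auto)
  moreover have "\<forall>\<^sub>F X in at_top. ((\<Sum>n. f (real n) * sin (real n / X)) / (X * f X) - (\<Sum>n<2. f (real n) * sin (real n / X)) / (X * f X))
      * (f X / (X powr (- \<theta>) * ln X powr \<kappa>)) / leading =
      mathieu_sin_series \<mu> r \<alpha> \<beta> \<gamma> \<delta> (inverse X) / (leading * (X powr (1 - \<theta>) * ln X powr \<kappa>))"
    using eventually_gt_at_top[of 1] eventually_f_pos
  proof eventually_elim
    case (elim X)
    let ?S = "(\<Sum>n. f (real n) * sin (real n / X)) - (\<Sum>n<2. f (real n) * sin (real n / X))"
    have "mathieu_sin_series \<mu> r \<alpha> \<beta> \<gamma> \<delta> (inverse X) = ?S"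
    proof -
      have "0 < inverse X" "inverse X \<le> 1" using elim by (auto simp: inverse_le_1_iff)
      from summable_mathieu_sin_term(2)[OF \<theta>(1) \<kappa> this] show ?thesis
        unfolding divide_inverse .
    qed
    moreover have "X powr (1 - \<theta>) = X * X powr (- \<theta>)"
      using elim powr_add[of X 1 "- \<theta>"] by simp
    moreover have "S / (X * F) * (F / (P * L)) / l = S / (l * (X * P * L))" if "F > 0" for S F P L l :: real
      using that by simp
    ultimately show ?case using elim by (simp only: diff_divide_distrib[symmetric])
  qed
  ultimately show ?thesis using leading_pos[OF \<theta>] by (simp add: tendsto_cong)
qed

end

text \<open>Eventual summability is stated next to the asymptotic relation because
  \<open>suminf\<close> also denotes some real number, without meaning, for a divergent
  series.\<close>

theorem proposition4p3:
  fixes \<mu> r \<alpha> \<beta> \<gamma> \<delta> \<theta> :: real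
  assumes "\<mu> \<ge> 0" and "r \<ge> 0"
    and "\<theta> = \<beta> * (\<mu> + 1) - \<alpha>"
    and "0 \<le> \<theta>" and "\<theta> < 2"
    and "\<theta> = 0 \<Longrightarrow> \<gamma> - \<delta> * (\<mu> + 1) < 0"
    and "r = 0 \<or> \<beta> > 0 \<or> (\<beta> = 0 \<and> \<delta> > 0)"
  shows "(\<forall>\<^sub>F x in at_right 0. summable (mathieu_sin_term \<mu> r \<alpha> \<beta> \<gamma> \<delta> x)) \<and>
    mathieu_sin_series \<mu> r \<alpha> \<beta> \<gamma> \<delta> \<sim>[at_right 0]
      (\<lambda>x. if \<theta> = 0 then 1 / x * ln (1 / x) powr (\<gamma> - \<delta> * (\<mu> + 1))
           else pi / (2 * Gamma \<theta> * sin (pi * \<theta> / 2)) * x powr (\<theta> - 1)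
                  * ln (1 / x) powr (\<gamma> - \<delta> * (\<mu> + 1)))"
proof -
  interpret M: mathieu \<mu> r \<alpha> \<beta> \<gamma> \<delta>
    by standard (use assms in auto)
  have \<theta>: "M.\<theta> = \<theta>" and \<kappa>: "M.\<kappa> = \<gamma> - \<delta> * (\<mu> + 1)"
    using assms(3) by (simp_all add: M.\<theta>_def M.\<kappa>_def)
  have a: "0 \<le> M.\<theta>" "M.\<theta> < 2" "M.\<theta> = 0 \<Longrightarrow> M.\<kappa> < 0"
    using assms unfolding \<theta> \<kappa> by auto
  have "\<forall>\<^sub>F x in at_right 0. summable (mathieu_sin_term \<mu> r \<alpha> \<beta> \<gamma> \<delta> x)"
    using eventually_at_right_real[of 0 1, OF zero_less_one]
    by eventually_elim (use M.summable_mathieu_sin_term(1)[OF a(1,3)] in auto)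
  moreover have "mathieu_sin_series \<mu> r \<alpha> \<beta> \<gamma> \<delta> \<sim>[at_right 0]
      (\<lambda>x. if \<theta> = 0 then 1 / x * ln (1 / x) powr (\<gamma> - \<delta> * (\<mu> + 1))
           else pi / (2 * Gamma \<theta> * sin (pi * \<theta> / 2)) * x powr (\<theta> - 1)
                  * ln (1 / x) powr (\<gamma> - \<delta> * (\<mu> + 1)))" (is "_ \<sim>[_] ?rhs")
  \<comment> \<open>The substitution \<open>x = inverse X\<close> turns the limit at 0 from the
    right into one at infinity, the form of \<open>mathieu_sin_series_limit\<close>.\<close>
  proof (rule asymp_equivI', subst filterlim_at_right_to_top)
    have "\<forall>\<^sub>F X in at_top. mathieu_sin_series \<mu> r \<alpha> \<beta> \<gamma> \<delta> (inverse X) /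
        (M.leading * (X powr (1 - M.\<theta>) * ln X powr M.\<kappa>)) =
        mathieu_sin_series \<mu> r \<alpha> \<beta> \<gamma> \<delta> (inverse X) / ?rhs (inverse X)"
      using eventually_gt_at_top[of 1]
    proof eventually_elim
      case (elim X)
      have "inverse X powr (\<theta> - 1) = X powr (1 - \<theta>)"
        using elim by (simp add: powr_def ln_inverse algebra_simps)
      moreover have "1 / inverse X = X" by (simp add: inverse_eq_divide)
      ultimately have "?rhs (inverse X) = M.leading * (X powr (1 - \<theta>) * ln X powr M.\<kappa>)"
        using elim by (simp only: M.leading_def \<theta> \<kappa>) simp
      then show ?case unfolding \<theta> by simp
    qed
    from tendsto_cong[OF this] M.mathieu_sin_series_limit[OF a]
    show "((\<lambda>X. mathieu_sin_series \<mu> r \<alpha> \<beta> \<gamma> \<delta> (inverse X) / ?rhs (inverse X)) \<longlongrightarrow> 1) at_top"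
      by blast
  qed
  ultimately show ?thesis by blast
qed

end
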